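(* Let $n\ge 3$ be an integer. There exists a positive real number $M$ such that for all $\varepsilon>M$ and all $r=(r_1,r_2)\in\ell$, we have $\#\mathcal{F}_n^{\mathrm{bin}}(L(r),\varepsilon,X)\gg_r X^{(n+1)/(2n-2)-(r_2-r_1)}$, i.e. there are a constant $c>0$ depending on $r$ (with $n,\varepsilon$ fixed) and $X_0$ such that $\#\mathcal{F}_n^{\mathrm{bin}}(L(r),\varepsilon,X)\ge c\,X^{(n+1)/(2n-2)-(r_2-r_1)}$ for all $X\ge X_0$.
   Context: To an integral binary $n$-ic form $f=f_0x^n+\dots+f_ny^n$, Birch–Merriman and Nakagawa attach a rank $n$ ring $R_f$ (a commutative ring isomorphic to $\mathbb{Z}^n$ additively) with $\mathrm{Disc}(R_f)=\mathrm{Disc}(f)$; this is compatible with the $\mathrm{GL}_2(\mathbb{Z})$-action on forms. Let $\Delta=|\mathrm{Disc}(f)|$. For a nondegenerate rank $n$ ring $R$ with homomorphisms $\sigma_1,\dots,\sigma_n:R\to\mathbb{C}$, let $|x|=\sqrt{\frac1n\sum|\sigma_i(x)|^2}$ and let $\lambda_i(R)$ be the smallest $r$ such that $R$ contains $i+1$ linearly independent elements of length $\le r$. For $p\in\mathbb{R}^{n-1}$, $\varepsilon>0$, $X>1$, $\mathcal{F}_n^{\mathrm{bin}}(p,\varepsilon,X)$ is the set of $\mathrm{GL}_2(\mathbb{Z})$-orbits of $f\in\mathrm{Sym}^n\mathbb{Z}^2$ with $0<\Delta\le X$ and $\max_{1\le i<n}|\log_\Delta\lambda_i(R_f)-p_i|\le\varepsilon/\log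 X$. Let $k=\frac{1}{2(1+2+\dots+(n-1))}$, let $\ell$ be the closed segment from $(0,k)$ to $(k/2,k/2)$, and let $L:\ell\to\mathbb{R}^{n-1}$ be the affine-linear map with $L(0,k)=(k,2k,\dots,(n-1)k)$ and $L(k/2,k/2)=\frac{1}{2(n-1)}(1,\dots,1)$. *)

theory Defs
  imports
    "HOL-Analysis.Analysis"
    "HOL-Algebra.Ring"
    "Subresultants.Resultant_Prelim"
begin

section \<open>Integral binary forms\<close>

text \<open>
  An integral binary \<open>n\<close>-ic form \<open>f\<^sub>0 x\<^sup>n + f\<^sub>1 x\<^sup>n\<^sup>-\<^sup>1 y + \<dots> + f\<^sub>n y\<^sup>n\<close> is represented by its
  coefficient sequence, padded with zeros beyond \<open>n\<close> (so that equality of forms is equality of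
  sequences). The leading coefficient may vanish.
\<close>

definition binary_forms :: "nat \<Rightarrow> (nat \<Rightarrow> int) set" where
  "binary_forms n = {f. \<forall>i>n. f i = 0}"

definition form_eval :: "nat \<Rightarrow> (nat \<Rightarrow> int) \<Rightarrow> int \<Rightarrow> int \<Rightarrow> int" where
  "form_eval n f x y = (\<Sum>i\<le>n. f i * x ^ (n - i) * y ^ i)"

text \<open>
  The orbit of \<open>f\<close> under linear substitutions by integer matrices of determinant \<open>\<plusminus>1\<close>. A form over
  the integers is determined by its values at integer points.
\<close>

definition gl2_orbit :: "nat \<Rightarrow> (nat \<Rightarrow> int) \<Rightarrow> (nat \<Rightarrow> int) set" where
  "gl2_orbit n f = {h \<in> binary_forms n. \<exists>a b c d :: int. \<bar>a * d - b * c\<bar> = 1 \<and>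
     (\<forall>x y. form_eval n h x y = form_eval n f (a * x + b * y) (c * x + d * y))}"

text \<open>
  The discriminant, normalised so that \<open>f = \<Prod>i. (\<alpha>\<^sub>i x - \<beta>\<^sub>i y)\<close> has discriminant
  \<open>\<Prod>i<j. (\<alpha>\<^sub>i \<beta>\<^sub>j - \<alpha>\<^sub>j \<beta>\<^sub>i)\<^sup>2\<close>, is \<open>(-1)^(n(n-1)/2) / n^(n-2)\<close> times the resultant of the two partial
  derivatives, both taken as binary forms of degree \<open>n - 1\<close>. The polynomials below are these partial
  derivatives at \<open>y = 1\<close>; the Sylvester matrix is formed with the formal degree \<open>n - 1\<close> (not the
  actual degree, which may drop), so the formula is valid also for vanishing leading coefficient.
\<close>

definition form_dx :: "nat \<Rightarrow> (nat \<Rightarrow> int) \<Rightarrow> int poly" where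
  "form_dx n f = (\<Sum>i<n. monom (int (n - i) * f i) (n - i - 1))"

definition form_dy :: "nat \<Rightarrow> (nat \<Rightarrow> int) \<Rightarrow> int poly" where
  "form_dy n f = (\<Sum>i=1..n. monom (int i * f i) (n - i))"

definition form_disc :: "nat \<Rightarrow> (nat \<Rightarrow> int) \<Rightarrow> real" where
  "form_disc n f = (-1) ^ (n * (n - 1) div 2) *
     real_of_int (Determinant.det (sylvester_mat_sub (n - 1) (n - 1) (form_dx n f) (form_dy n f))) /
     real n ^ (n - 2)"


section \<open>The rank \<open>n\<close> ring of a binary form\<close>

text \<open>
  The ring has \<open>\<int>\<close>-basis \<open>\<zeta>\<^sub>0 = 1, \<zeta>\<^sub>1, \<dots>, \<zeta>\<^sub>n\<^sub>-\<^sub>1\<close>; if \<open>f\<^sub>0 \<noteq> 0\<close> then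
  \<open>\<zeta>\<^sub>k = f\<^sub>0 \<theta>\<^sup>k + f\<^sub>1 \<theta>\<^sup>k\<^sup>-\<^sup>1 + \<dots> + f\<^sub>k\<^sub>-\<^sub>1 \<theta>\<close> for \<open>k > 0\<close>, where \<open>\<theta>\<close> is the image of \<open>x\<close> in
  \<open>\<rat>[x]/(f(x,1))\<close>. The multiplication table is, for \<open>1 \<le> i \<le> j < n\<close> and with \<open>\<zeta>\<^sub>n = -f\<^sub>n\<close>,
  \<open>\<zeta>\<^sub>i \<zeta>\<^sub>j = \<Sum>j<k\<le>min(i+j,n). f\<^sub>i\<^sub>+\<^sub>j\<^sub>-\<^sub>k \<zeta>\<^sub>k - \<Sum>max(i+j-n,1)\<le>k\<le>i. f\<^sub>i\<^sub>+\<^sub>j\<^sub>-\<^sub>k \<zeta>\<^sub>k\<close>,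
  which makes sense for every \<open>f\<close>.

  \<open>form_zeta n f k\<close> and \<open>form_zeta_mult n f i j\<close> are the coordinate vectors of \<open>\<zeta>\<^sub>k\<close> (\<open>k \<le> n\<close>) and of
  \<open>\<zeta>\<^sub>i \<zeta>\<^sub>j\<close> (\<open>i, j < n\<close>) in this basis.
\<close>

definition form_zeta :: "nat \<Rightarrow> (nat \<Rightarrow> int) \<Rightarrow> nat \<Rightarrow> nat \<Rightarrow> int" where
  "form_zeta n f k m =
     (if k < n then (if m = k then 1 else 0) else (if m = 0 then - f n else 0))"

definition form_zeta_mult :: "nat \<Rightarrow> (nat \<Rightarrow> int) \<Rightarrow> nat \<Rightarrow> nat \<Rightarrow> nat \<Rightarrow> int" where
  "form_zeta_mult n f i j m =
     (if i = 0 then form_zeta n f j m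
      else if j = 0 then form_zeta n f i m
      else (\<Sum>k \<in> {max i j<..min (i + j) n}. f (i + j - k) * form_zeta n f k m)
         - (\<Sum>k \<in> {max (i + j - n) 1..min i j}. f (i + j - k) * form_zeta n f k m))"

definition form_ring :: "nat \<Rightarrow> (nat \<Rightarrow> int) \<Rightarrow> (nat \<Rightarrow> int) ring" where
  "form_ring n f = \<lparr>
     carrier = {u. \<forall>m\<ge>n. u m = 0},
     monoid.mult = (\<lambda>u v m. \<Sum>i<n. \<Sum>j<n. u i * v j * form_zeta_mult n f i j m),
     one = form_zeta n f 0,
     zero = (\<lambda>m. 0),
     add = (\<lambda>u v m. u m + v m)\<rparr>"


section \<open>Successive minima of a nondegenerate rank \<open>n\<close> ring\<close>

abbreviation complex_ring :: "complex ring" where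
  "complex_ring \<equiv> \<lparr>carrier = UNIV, monoid.mult = (*), one = 1, zero = 0, add = (+)\<rparr>"

text \<open>
  Restricting to extensional functions makes each homomorphism be counted once. For a nondegenerate
  ring of rank \<open>n\<close> there are exactly \<open>n\<close> of them.
\<close>

definition complex_homs :: "('a, 'b) ring_scheme \<Rightarrow> ('a \<Rightarrow> complex) set" where
  "complex_homs R = Ring.ring_hom R complex_ring \<inter> extensional (carrier R)"

definition ring_length :: "nat \<Rightarrow> ('a, 'b) ring_scheme \<Rightarrow> 'a \<Rightarrow> real" where
  "ring_length n R x = sqrt (1 / real n * (\<Sum>\<sigma>\<in>complex_homs R. (cmod (\<sigma> x))\<^sup>2))"

definition int_independent :: "('a, 'b) ring_scheme \<Rightarrow> nat \<Rightarrow> (nat \<Rightarrow> 'a) \<Rightarrow> bool" where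
  "int_independent R k v \<longleftrightarrow> v \<in> {..<k} \<rightarrow> carrier R \<and>
     (\<forall>c :: nat \<Rightarrow> int. (\<Oplus>\<^bsub>R\<^esub>j\<in>{..<k}. [c j] \<cdot>\<^bsub>R\<^esub> v j) = \<zero>\<^bsub>R\<^esub> \<longrightarrow> (\<forall>j<k. c j = 0))"

definition succ_min :: "nat \<Rightarrow> ('a, 'b) ring_scheme \<Rightarrow> nat \<Rightarrow> real" where
  "succ_min n R i = (LEAST r. \<exists>v. int_independent R (i + 1) v \<and>
     (\<forall>j<i + 1. ring_length n R (v j) \<le> r))"


section \<open>Forms with prescribed successive minima\<close>

text \<open>
  A point of \<open>\<real>\<^sup>n\<^sup>-\<^sup>1\<close> is a function \<open>p\<close> of which only the values at \<open>1, \<dots>, n - 1\<close> are used. The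
  library's \<open>log 1\<close> is the zero function, so for forms with \<open>\<bar>Disc f\<bar> = 1\<close> the last
  condition reads \<open>\<bar>p i\<bar> \<le> \<epsilon> / ln X\<close>; when some \<open>p i \<noteq> 0\<close>, it excludes them for all large \<open>X\<close>.
\<close>

definition forms_with_minima ::
    "nat \<Rightarrow> (nat \<Rightarrow> real) \<Rightarrow> real \<Rightarrow> real \<Rightarrow> (nat \<Rightarrow> int) set set" where
  "forms_with_minima n p \<epsilon> X = gl2_orbit n ` {f \<in> binary_forms n.
     0 < \<bar>form_disc n f\<bar> \<and> \<bar>form_disc n f\<bar> \<le> X \<and>
     (\<forall>i\<in>{1..<n}. \<bar>log \<bar>form_disc n f\<bar> (succ_min n (form_ring n f) i) - p i\<bar> \<le> \<epsilon> / ln X)}"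

definition kappa :: "nat \<Rightarrow> real" where
  "kappa n = 1 / (2 * (\<Sum>i=1..n - 1. real i))"

definition seg :: "nat \<Rightarrow> (real \<times> real) set" where
  "seg n = closed_segment (0, kappa n) (kappa n / 2, kappa n / 2)"

text \<open>
  The affine map with \<open>(0, k) \<mapsto> (k, 2k, \<dots>, (n-1)k)\<close> and
  \<open>(k/2, k/2) \<mapsto> (1, \<dots>, 1) / (2(n-1))\<close>: on the segment, \<open>2 r\<^sub>1 / k\<close> is the parameter running from
  \<open>0\<close> at the first endpoint to \<open>1\<close> at the second.
\<close>

definition seg_map :: "nat \<Rightarrow> real \<times> real \<Rightarrow> nat \<Rightarrow> real" where
  "seg_map n r i = (let t = 2 * fst r / kappa n in
     (1 - t) * (real i * kappa n) + t * (1 / (2 * (real n - 1))))"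

end

theory Submission
  imports Defs "Jordan_Normal_Form.Char_Poly"
begin

text \<open>
  Take forms with \<open>f\<^sub>i\<close> within \<open>\<delta> A B\<^sup>i\<close> of the coefficient of \<open>A (x\<^sup>n + (B y)\<^sup>n)\<close> and \<open>f\<^sub>1\<close> even of size
  at most \<open>\<delta> A\<close>, which uses up the translations \<open>x \<mapsto> x + m y\<close>. Their discriminant is of order
  \<open>A\<^sup>2\<^sup>n\<^sup>-\<^sup>2 B\<^sup>n\<^sup>(\<^sup>n\<^sup>-\<^sup>1\<^sup>)\<close>, the basis \<open>\<zeta>\<^sub>i\<close> of the ring is almost orthogonal, and \<open>\<zeta>\<^sub>i\<close> has length of
  order \<open>A B\<^sup>i\<close>; so \<open>\<lambda>\<^sub>i\<close> is of order \<open>A B\<^sup>i\<close>. If \<open>t \<in> [0, 1]\<close> is the parameter of \<open>r\<close> on the segment, the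
  choice \<open>A = X\<^sup>t\<^sup>/\<^sup>(\<^sup>2\<^sup>n\<^sup>-\<^sup>2\<^sup>)\<close>, \<open>B = X\<^sup>(\<^sup>1\<^sup>-\<^sup>t\<^sup>)\<^sup>k\<close>, up to constants, gives the required minima, and the box
  contains about \<open>A\<^sup>n\<^sup>+\<^sup>1 B\<^sup>n\<^sup>(\<^sup>n\<^sup>+\<^sup>1\<^sup>)\<^sup>/\<^sup>2\<^sup>-\<^sup>1\<close> forms.

  An orbit meets the box in a bounded number of forms: if \<open>h = f \<circ> \<gamma>\<close> with both in the box, then
  the gradient of \<open>f\<close> at a column of \<open>\<gamma>\<close> of (rescaled) size \<open>s\<close> is of order \<open>s\<^sup>n\<^sup>-\<^sup>1\<close>, because the gradient of
  \<open>x\<^sup>n + y\<^sup>n\<close> vanishes only at the origin; but it is also \<open>O(s)\<close>, being the image under \<open>\<gamma>\<^sup>-\<^sup>T\<close> of the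
  gradient of \<open>h\<close> at a unit vector. As \<open>n \<ge> 3\<close>, this bounds \<open>s\<close>.
\<close>

section \<open>The complex embeddings of the ring of a form\<close>

text \<open>For k > 0 this is the value at \<theta> of the basis element zeta_k. At k = 0 it is 0
  instead of 1, which makes the recursion in k and the product identity uniform;
  \<open>basis_val\<close> restores the 1.\<close>

definition zeta_val :: "(nat \<Rightarrow> int) \<Rightarrow> complex \<Rightarrow> nat \<Rightarrow> complex" where
  "zeta_val f \<theta> k = (\<Sum>m<k. of_int (f m) * \<theta> ^ (k - m))"

lemma zeta_val_0 [simp]: "zeta_val f \<theta> 0 = 0"
  by (simp add: zeta_val_def)

lemma zeta_val_Suc: "zeta_val f \<theta> (Suc k) = \<theta> * (zeta_val f \<theta> k + of_int (f k))"
proof -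
  have "(\<Sum>m<k. of_int (f m) * \<theta> ^ (Suc k - m)) = \<theta> * (\<Sum>m<k. of_int (f m) * \<theta> ^ (k - m))"
    unfolding sum_distrib_left by (rule sum.cong) (auto simp: Suc_diff_le)
  then show ?thesis by (simp add: zeta_val_def algebra_simps)
qed

text \<open>The multiplication table before truncation, an identity in \<theta> that holds away from
  roots as well. In the induction on i, the recursion for \<open>zeta_val\<close> shifts both sums
  by one index at the cost of sums quadratic in the coefficients, and these cancel.\<close>

lemma zeta_val_mult:
  "zeta_val f \<theta> i * zeta_val f \<theta> j =
     (\<Sum>k=Suc j..i + j. of_int (f (i + j - k)) * zeta_val f \<theta> k)
   - (\<Sum>k=1..i. of_int (f (i + j - k)) * zeta_val f \<theta> k)"
proof (induction i)
  case 0
  then show ?case by simp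
next
  case (Suc i)
  let ?s = "zeta_val f \<theta>"
  let ?f = "\<lambda>k. complex_of_int (f k)"
  have shift: "(\<Sum>k=Suc a..Suc b. ?f (Suc i + j - k) * ?s k)
      = \<theta> * ((\<Sum>k=a..b. ?f (i + j - k) * ?s k) + (\<Sum>k=a..b. ?f (i + j - k) * ?f k))" for a b
    unfolding sum.shift_bounds_cl_Suc_ivl sum.distrib[symmetric] sum_distrib_left
    by (rule sum.cong) (auto simp: zeta_val_Suc algebra_simps)
  \<comment> \<open>The quadratic terms left by the two shifts agree under k -> i + j - k.\<close>
  have reflect: "(\<Sum>k=j..i+j. ?f (i + j - k) * ?f k) = (\<Sum>k=0..i. ?f (i + j - k) * ?f k)"
    by (rule sum.reindex_bij_witness[of _ "\<lambda>k. i + j - k" "\<lambda>k. i + j - k"]) auto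
  have left: "(\<Sum>k=j..i+j. ?f (i + j - k) * ?s k)
      = ?f i * ?s j + (\<Sum>k=Suc j..i+j. ?f (i + j - k) * ?s k)"
    by (subst sum.atLeast_Suc_atMost) auto
  have right: "(\<Sum>k=0..i. ?f (i + j - k) * ?s k) = (\<Sum>k=1..i. ?f (i + j - k) * ?s k)"
    by (subst sum.atLeast_Suc_atMost) auto
  have upper: "(\<Sum>k=Suc j..Suc i+j. ?f (Suc i + j - k) * ?s k)
      = \<theta> * (?f i * ?s j + (\<Sum>k=Suc j..i+j. ?f (i + j - k) * ?s k)
          + (\<Sum>k=0..i. ?f (i + j - k) * ?f k))"
    using shift[of j "i+j"] unfolding left reflect by simp
  have lower: "(\<Sum>k=1..Suc i. ?f (Suc i + j - k) * ?s k)
      = \<theta> * ((\<Sum>k=1..i. ?f (i + j - k) * ?s k) + (\<Sum>k=0..i. ?f (i + j - k) * ?f k))"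
    using shift[of 0 i] unfolding right by simp
  have "(\<Sum>k=Suc j..Suc i+j. ?f (Suc i + j - k) * ?s k) - (\<Sum>k=1..Suc i. ?f (Suc i + j - k) * ?s k)
     = \<theta> * (?f i * ?s j + ((\<Sum>k=Suc j..i+j. ?f (i + j - k) * ?s k)
          - (\<Sum>k=1..i. ?f (i + j - k) * ?s k)))"
    unfolding upper lower by (simp only: ring_distribs) simp
  also have "\<dots> = \<theta> * (?f i * ?s j + ?s i * ?s j)"
    by (simp only: Suc.IH)
  also have "\<dots> = ?s (Suc i) * ?s j"
    by (simp add: zeta_val_Suc algebra_simps)
  finally show ?case by simp
qed

section \<open>Evaluation of the multiplication table at a root\<close>

definition form_poly :: "nat \<Rightarrow> (nat \<Rightarrow> int) \<Rightarrow> complex poly" where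
  "form_poly n f = (\<Sum>i\<le>n. monom (of_int (f i)) (n - i))"

lemma poly_form_poly: "poly (form_poly n f) x = (\<Sum>i\<le>n. of_int (f i) * x ^ (n - i))"
  by (simp add: form_poly_def poly_sum poly_monom)

lemma poly_form_poly_zeta_val: "poly (form_poly n f) \<theta> = zeta_val f \<theta> n + of_int (f n)"
  by (simp add: poly_form_poly zeta_val_def flip: lessThan_Suc_atMost)

text \<open>At a root zeta_n + f_n = 0, so the recursion gives 0 at n + 1; it stays 0 because the
  coefficients vanish beyond n.\<close>

lemma zeta_val_eq_0:
  assumes "f \<in> binary_forms n" "poly (form_poly n f) \<theta> = 0" "k > n"
  shows "zeta_val f \<theta> k = 0"
proof -
  have "zeta_val f \<theta> (Suc n + d) = 0" for d
  proof (induction d)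
    case 0
    then show ?case using assms(2) by (simp add: poly_form_poly_zeta_val zeta_val_Suc)
  next
    case (Suc d)
    then show ?case using assms(1) zeta_val_Suc[of f \<theta> "Suc n + d"] by (simp add: binary_forms_def)
  qed
  from this[of "k - Suc n"] show ?thesis using assms(3) by simp
qed

definition basis_val :: "(nat \<Rightarrow> int) \<Rightarrow> complex \<Rightarrow> nat \<Rightarrow> complex" where
  "basis_val f \<theta> k = (if k = 0 then 1 else zeta_val f \<theta> k)"

text \<open>At k = n the convention zeta_n = -f_n built into \<open>form_zeta\<close> is exactly the
  equation f(\<theta>, 1) = 0, so the top index of the table is covered too.\<close>

lemma sum_form_zeta_basis_val:
  assumes "poly (form_poly n f) \<theta> = 0" "0 < k" "k \<le> n"
  shows "(\<Sum>m<n. of_int (form_zeta n f k m) * basis_val f \<theta> m) = zeta_val f \<theta> k"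
proof (cases "k < n")
  case True
  have "(\<Sum>m<n. of_int (form_zeta n f k m) * basis_val f \<theta> m)
      = (\<Sum>m<n. if m = k then basis_val f \<theta> m else 0)"
    using True by (intro sum.cong) (auto simp: form_zeta_def)
  also have "\<dots> = zeta_val f \<theta> k"
    using True assms(2) by (simp add: basis_val_def)
  finally show ?thesis .
next
  case False
  have "(\<Sum>m<n. of_int (form_zeta n f k m) * basis_val f \<theta> m)
      = (\<Sum>m<n. if m = 0 then - of_int (f n) else 0)"
    using False by (intro sum.cong) (auto simp: form_zeta_def basis_val_def)
  also have "\<dots> = zeta_val f \<theta> n"
    using assms by (simp add: poly_form_poly_zeta_val add_eq_0_iff2)
  finally show ?thesis using False assms(3) by simp
qed

lemma sum_form_zeta_mult_basis_val:
  assumes f: "f \<in> binary_forms n" and root: "poly (form_poly n f) \<theta> = 0" and ij: "i < n" "j < n"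
  shows "(\<Sum>m<n. of_int (form_zeta_mult n f i j m) * basis_val f \<theta> m)
       = basis_val f \<theta> i * basis_val f \<theta> j"
proof -
  have unit: "(\<Sum>m<n. of_int (form_zeta n f k m) * basis_val f \<theta> m) = basis_val f \<theta> k"
    if "k < n" for k
  proof -
    have "(\<Sum>m<n. of_int (form_zeta n f k m) * basis_val f \<theta> m)
        = (\<Sum>m<n. if m = k then basis_val f \<theta> m else 0)"
      using that by (intro sum.cong) (auto simp: form_zeta_def)
    then show ?thesis using that by simp
  qed
  consider "i = 0" | "i \<noteq> 0" "j = 0" | "i > 0" "j > 0" by auto
  then show ?thesis
  proof cases
    case 3
    let ?s = "zeta_val f \<theta>" and ?b = "basis_val f \<theta>"
    let ?S = "{max i j<..min (i + j) n}" and ?T = "{max (i + j - n) 1..min i j}"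
    let ?g = "\<lambda>k. complex_of_int (f (i + j - k)) * ?s k"
    have swap: "(\<Sum>m<n. (\<Sum>k\<in>A. complex_of_int (f (i + j - k)) * of_int (form_zeta n f k m)) * ?b m)
       = (\<Sum>k\<in>A. ?g k)" if "A \<subseteq> {1..n}" for A
    proof -
      have "(\<Sum>m<n. (\<Sum>k\<in>A. complex_of_int (f (i + j - k)) * of_int (form_zeta n f k m)) * ?b m)
        = (\<Sum>k\<in>A. complex_of_int (f (i + j - k)) * (\<Sum>m<n. of_int (form_zeta n f k m) * ?b m))"
        unfolding sum_distrib_right sum_distrib_left
        by (subst sum.swap) (simp add: mult.assoc)
      also have "\<dots> = (\<Sum>k\<in>A. ?g k)"
        using that sum_form_zeta_basis_val[OF root] by (intro sum.cong) auto
      finally show ?thesis .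
    qed
    have "(\<Sum>m<n. of_int (form_zeta_mult n f i j m) * ?b m)
       = (\<Sum>m<n. (\<Sum>k\<in>?S. complex_of_int (f (i + j - k)) * of_int (form_zeta n f k m)) * ?b m)
       - (\<Sum>m<n. (\<Sum>k\<in>?T. complex_of_int (f (i + j - k)) * of_int (form_zeta n f k m)) * ?b m)"
      using 3 by (simp add: form_zeta_mult_def algebra_simps sum_subtractf)
    also have "\<dots> = sum ?g ?S - sum ?g ?T"
      using ij by (subst (1 2) swap) auto
    \<comment> \<open>Terms with k > n vanish by \<open>zeta_val_eq_0\<close>.\<close>
    also have "sum ?g ?S = sum ?g {Suc (max i j)..min i j + max i j}"
      using zeta_val_eq_0[OF f root] by (intro sum.mono_neutral_left) auto
    \<comment> \<open>Terms with k < i + j - n carry a coefficient of index beyond n, which is 0 by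
      the padding of forms.\<close>
    also have "sum ?g ?T = sum ?g {1..min i j}"
      using f by (intro sum.mono_neutral_left) (auto simp: binary_forms_def)
    also have "sum ?g {Suc (max i j)..min i j + max i j} - sum ?g {1..min i j}
        = ?s (min i j) * ?s (max i j)"
      by (simp add: zeta_val_mult min_add_distrib_left[symmetric] min_def max_def add.commute)
    also have "\<dots> = ?b i * ?b j"
      using 3 by (simp add: basis_val_def min_def max_def mult.commute)
    finally show ?thesis .
  qed (use ij unit in \<open>auto simp: form_zeta_mult_def basis_val_def\<close>)
qed

section \<open>Homomorphisms to the complex numbers correspond to roots\<close>

lemma form_ring_simps [simp]:
  "carrier (form_ring n f) = {u. \<forall>m\<ge>n. u m = 0}"
  "u \<otimes>\<^bsub>form_ring n f\<^esub> v = (\<lambda>m. \<Sum>i<n. \<Sum>j<n. u i * v j * form_zeta_mult n f i j m)"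
  "\<one>\<^bsub>form_ring n f\<^esub> = form_zeta n f 0"
  "\<zero>\<^bsub>form_ring n f\<^esub> = (\<lambda>m. 0)"
  "u \<oplus>\<^bsub>form_ring n f\<^esub> v = (\<lambda>m. u m + v m)"
  by (simp_all add: form_ring_def)

lemma form_zeta_eq_0: "0 < n \<Longrightarrow> m \<ge> n \<Longrightarrow> form_zeta n f k m = 0"
  by (auto simp: form_zeta_def)

lemma form_zeta_mult_eq_0: "0 < n \<Longrightarrow> m \<ge> n \<Longrightarrow> form_zeta_mult n f i j m = 0"
  by (auto simp: form_zeta_mult_def form_zeta_eq_0)

definition root_hom :: "nat \<Rightarrow> (nat \<Rightarrow> int) \<Rightarrow> complex \<Rightarrow> (nat \<Rightarrow> int) \<Rightarrow> complex" where
  "root_hom n f \<theta> = (\<lambda>u\<in>carrier (form_ring n f). \<Sum>k<n. of_int (u k) * basis_val f \<theta> k)"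

lemma root_hom_complex_homs:
  assumes f: "f \<in> binary_forms n" and root: "poly (form_poly n f) \<theta> = 0" and n: "0 < n"
  shows "root_hom n f \<theta> \<in> complex_homs (form_ring n f)"
proof -
  let ?b = "basis_val f \<theta>"
  have mult: "(\<Sum>m<n. of_int (\<Sum>i<n. \<Sum>j<n. u i * v j * form_zeta_mult n f i j m) * ?b m)
      = (\<Sum>k<n. of_int (u k) * ?b k) * (\<Sum>k<n. of_int (v k) * ?b k)" for u v
  proof -
    have "(\<Sum>m<n. of_int (\<Sum>i<n. \<Sum>j<n. u i * v j * form_zeta_mult n f i j m) * ?b m)
      = (\<Sum>m<n. \<Sum>i<n. \<Sum>j<n. of_int (u i) * of_int (v j) * (of_int (form_zeta_mult n f i j m) * ?b m))"
      by (simp add: sum_distrib_right mult.assoc)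
    also have "\<dots> = (\<Sum>i<n. \<Sum>j<n. \<Sum>m<n. of_int (u i) * of_int (v j) * (of_int (form_zeta_mult n f i j m) * ?b m))"
      by (subst sum.swap, rule sum.cong[OF refl], subst sum.swap, rule refl)
    also have "\<dots> = (\<Sum>i<n. \<Sum>j<n. of_int (u i) * of_int (v j) * (?b i * ?b j))"
      by (simp add: sum_distrib_left[symmetric] sum_form_zeta_mult_basis_val[OF f root])
    also have "\<dots> = (\<Sum>k<n. of_int (u k) * ?b k) * (\<Sum>k<n. of_int (v k) * ?b k)"
      by (simp add: sum_product mult_ac)
    finally show ?thesis .
  qed
  have one: "(\<Sum>k<n. of_int (form_zeta n f 0 k) * ?b k) = 1"
  proof -
    have "(\<Sum>k<n. of_int (form_zeta n f 0 k) * ?b k) = (\<Sum>k<n. if k = 0 then 1 else 0)"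
      using n by (intro sum.cong) (auto simp: form_zeta_def basis_val_def)
    then show ?thesis using n by simp
  qed
  show ?thesis
    unfolding complex_homs_def Ring.ring_hom_def root_hom_def
    using n one mult
    by (auto simp: form_zeta_eq_0 form_zeta_mult_eq_0 sum.distrib algebra_simps)
qed

lemma additive_form_ring:
  assumes add: "\<And>u v. u \<in> carrier (form_ring n f) \<Longrightarrow> v \<in> carrier (form_ring n f) \<Longrightarrow>
      \<sigma> (\<lambda>m. u m + v m) = \<sigma> u + (\<sigma> v :: complex)"
    and u: "u \<in> carrier (form_ring n f)"
  shows "\<sigma> (\<lambda>m. c * u m) = of_int c * \<sigma> u"
proof (induction c rule: int_induct[where k = 0])
  case base
  have "\<sigma> (\<lambda>m. 0 + 0) = \<sigma> (\<lambda>m. 0) + \<sigma> (\<lambda>m. 0)"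
    by (rule add) auto
  then show ?case by simp
next
  case (step1 i)
  have "\<sigma> (\<lambda>m. i * u m + u m) = \<sigma> (\<lambda>m. i * u m) + \<sigma> u"
    using u by (intro add) auto
  then show ?case using step1 by (simp add: algebra_simps)
next
  case (step2 i)
  have "\<sigma> (\<lambda>m. (i - 1) * u m + u m) = \<sigma> (\<lambda>m. (i - 1) * u m) + \<sigma> u"
    using u by (intro add) auto
  then show ?case using step2 by (simp add: algebra_simps)
qed

text \<open>Induction on the length of the truncations of u, adding one coordinate at a time; only
  additivity of \<sigma> enters.\<close>

lemma additive_form_ring_expand:
  assumes add: "\<And>u v. u \<in> carrier (form_ring n f) \<Longrightarrow> v \<in> carrier (form_ring n f) \<Longrightarrow>
      \<sigma> (\<lambda>m. u m + v m) = \<sigma> u + (\<sigma> v :: complex)"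
    and u: "u \<in> carrier (form_ring n f)"
  shows "\<sigma> u = (\<Sum>k<n. of_int (u k) * \<sigma> (form_zeta n f k))"
proof -
  have "\<sigma> (\<lambda>m. if m < l then u m else 0) = (\<Sum>k<l. of_int (u k) * \<sigma> (form_zeta n f k))"
    if "l \<le> n" for l
    using that
  proof (induction l)
    case 0
    have "\<sigma> (\<lambda>m. 0 * u m) = 0"
      using additive_form_ring[of n f \<sigma>, OF add u, of 0] by simp
    then show ?case by simp
  next
    case (Suc l)
    have carr: "form_zeta n f l \<in> carrier (form_ring n f)"
      using Suc.prems by (simp add: form_zeta_eq_0)
    have split: "(\<lambda>m. if m < Suc l then u m else 0)
        = (\<lambda>m. (if m < l then u m else 0) + u l * form_zeta n f l m)"
      using Suc.prems by (auto simp: form_zeta_def fun_eq_iff less_Suc_eq)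
    have "\<sigma> (\<lambda>m. if m < Suc l then u m else 0) = \<sigma> (\<lambda>m. if m < l then u m else 0) + \<sigma> (\<lambda>m. u l * form_zeta n f l m)"
      unfolding split using u carr by (intro add) auto
    also have "\<sigma> (\<lambda>m. u l * form_zeta n f l m) = of_int (u l) * \<sigma> (form_zeta n f l)"
      by (rule additive_form_ring[of n f \<sigma>, OF add carr])
    finally show ?case using Suc by simp
  qed
  from this[of n] have "\<sigma> (\<lambda>m. if m < n then u m else 0) = (\<Sum>k<n. of_int (u k) * \<sigma> (form_zeta n f k))"
    by simp
  moreover have "(\<lambda>m. if m < n then u m else 0) = u"
    using u by (auto simp: fun_eq_iff)
  ultimately show ?thesis by simp
qed

text \<open>This row of the table produces zeta_(j+1) from zeta_1 and zeta_j, up to j + 1 = n. For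
  nonzero f_0 a homomorphism is therefore determined by its value at zeta_1.\<close>

lemma form_zeta_mult_1:
  assumes "0 < j" "j < n"
  shows "form_zeta_mult n f 1 j m = f 0 * form_zeta n f (Suc j) m + - f j * form_zeta n f 1 m"
proof -
  have "{max 1 j<..min (1 + j) n} = {Suc j}" "{max (1 + j - n) 1..min 1 j} = {1}"
    using assms by auto
  then show ?thesis using assms by (simp add: form_zeta_mult_def)
qed

text \<open>The only candidate is \<theta> = \<sigma>(zeta_1) / f_0. The first row of the table
  forces all other values, and the convention for zeta_n forces \<theta> to be a root.\<close>

lemma complex_homs_root_hom:
  assumes n: "2 \<le> n" and f0: "f 0 \<noteq> 0" and hom: "\<sigma> \<in> complex_homs (form_ring n f)"
  obtains \<theta> where "poly (form_poly n f) \<theta> = 0" "\<sigma> = root_hom n f \<theta>"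
proof -
  let ?R = "form_ring n f"
  let ?e = "form_zeta n f"
  define \<theta> where "\<theta> = \<sigma> (?e 1) / of_int (f 0)"
  have add: "\<sigma> (\<lambda>m. u m + v m) = \<sigma> u + \<sigma> v" if "u \<in> carrier ?R" "v \<in> carrier ?R" for u v
    using hom that by (auto simp: complex_homs_def Ring.ring_hom_def)
  have mult: "\<sigma> (u \<otimes>\<^bsub>?R\<^esub> v) = \<sigma> u * \<sigma> v" if "u \<in> carrier ?R" "v \<in> carrier ?R" for u v
    using hom that by (auto simp: complex_homs_def Ring.ring_hom_def)
  have one: "\<sigma> (?e 0) = 1"
    using hom by (auto simp: complex_homs_def Ring.ring_hom_def)
  have carr: "?e k \<in> carrier ?R" for k
    using n by (simp add: form_zeta_eq_0)
  have mult_delta: "(if P then 1 else 0) * x = (if P then x else 0)" for P and x :: int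
    by simp
  have scale: "\<sigma> (\<lambda>m. c * ?e k m) = of_int c * \<sigma> (?e k)" for c k
    by (rule additive_form_ring[of n f \<sigma>, OF add carr])
  have prod: "\<sigma> (?e 1) * \<sigma> (?e j) = of_int (f 0) * \<sigma> (?e (Suc j)) - of_int (f j) * \<sigma> (?e 1)"
    if j: "0 < j" "j < n" for j
  proof -
    have "?e 1 \<otimes>\<^bsub>?R\<^esub> ?e j = (\<lambda>m. form_zeta_mult n f 1 j m)"
    proof
      fix m
      have "(?e 1 \<otimes>\<^bsub>?R\<^esub> ?e j) m
          = (\<Sum>i<n. if i = 1 then (\<Sum>l<n. if l = j then form_zeta_mult n f i l m else 0) else 0)"
        using n j unfolding form_ring_simps
        by (intro sum.cong refl) (simp add: form_zeta_def if_distribR mult_delta)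
      then show "(?e 1 \<otimes>\<^bsub>?R\<^esub> ?e j) m = form_zeta_mult n f 1 j m"
        using n j by simp
    qed
    also have "\<dots> = (\<lambda>m. f 0 * ?e (Suc j) m + - f j * ?e 1 m)"
      by (rule ext) (rule form_zeta_mult_1[OF j])
    finally have "\<sigma> (?e 1) * \<sigma> (?e j) = \<sigma> (\<lambda>m. f 0 * ?e (Suc j) m + - f j * ?e 1 m)"
      using mult[OF carr carr, of 1 j] by simp
    also have "\<dots> = \<sigma> (\<lambda>m. f 0 * ?e (Suc j) m) + \<sigma> (\<lambda>m. - f j * ?e 1 m)"
      using carr by (intro add) auto
    also have "\<dots> = of_int (f 0) * \<sigma> (?e (Suc j)) - of_int (f j) * \<sigma> (?e 1)"
      using scale[of "f 0" "Suc j"] scale[of "- f j" 1] by simp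
    finally show ?thesis .
  qed
  \<comment> \<open>The induction runs up to index n, one beyond the basis, since the last value
    yields the root condition.\<close>
  have zeta: "\<sigma> (?e (Suc k)) = zeta_val f \<theta> (Suc k)" if "Suc k \<le> n" for k
    using that
  proof (induction k)
    case 0
    then show ?case using f0 by (simp add: zeta_val_Suc \<theta>_def)
  next
    case (Suc k)
    have "of_int (f 0) * \<sigma> (?e (Suc (Suc k))) = \<sigma> (?e 1) * (\<sigma> (?e (Suc k)) + of_int (f (Suc k)))"
      using prod[of "Suc k"] Suc.prems by (simp add: algebra_simps)
    then have "\<sigma> (?e (Suc (Suc k))) = \<theta> * (\<sigma> (?e (Suc k)) + of_int (f (Suc k)))"
      using f0 by (simp add: \<theta>_def field_simps)
    then show ?case using Suc by (simp add: zeta_val_Suc[of _ _ "Suc k"])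
  qed
  have "?e n = (\<lambda>m. - f n * ?e 0 m)"
    using n by (auto simp: form_zeta_def fun_eq_iff)
  then have "\<sigma> (?e n) = - of_int (f n)"
    using scale[of "- f n" 0] one by simp
  moreover have "zeta_val f \<theta> n = \<sigma> (?e n)"
    using zeta[of "n - 1"] n by simp
  ultimately have root: "poly (form_poly n f) \<theta> = 0"
    by (simp add: poly_form_poly_zeta_val)
  have "\<sigma> u = root_hom n f \<theta> u" for u
  proof (cases "u \<in> carrier ?R")
    case True
    have "\<sigma> (?e k) = basis_val f \<theta> k" if "k < n" for k
      using one zeta[of "k - 1"] that by (cases k) (auto simp: basis_val_def)
    then show ?thesis
      using additive_form_ring_expand[of n f \<sigma>, OF add True] True by (simp add: root_hom_def)
  next
    case False
    then show ?thesis
      using hom unfolding complex_homs_def root_hom_def extensional_def by auto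
  qed
  then show thesis using root that by blast
qed

lemma complex_homs_form_ring:
  assumes "2 \<le> n" "f \<in> binary_forms n" "f 0 \<noteq> 0"
  shows "complex_homs (form_ring n f) = root_hom n f ` {\<theta>. poly (form_poly n f) \<theta> = 0}"
  using assms complex_homs_root_hom[of n f] root_hom_complex_homs[of f n] by (auto 4 3)

lemma inj_root_hom:
  assumes "2 \<le> n" "f 0 \<noteq> 0"
  shows "inj (root_hom n f)"
proof
  fix \<theta> \<theta>'
  assume eq: "root_hom n f \<theta> = root_hom n f \<theta>'"
  have "root_hom n f t (form_zeta n f 1) = of_int (f 0) * t" for t
  proof -
    have "root_hom n f t (form_zeta n f 1) = (\<Sum>k<n. of_int (form_zeta n f 1 k) * basis_val f t k)"
      using assms by (simp add: root_hom_def form_zeta_eq_0)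
    also have "\<dots> = (\<Sum>k<n. if k = 1 then basis_val f t k else 0)"
      using assms by (intro sum.cong) (auto simp: form_zeta_def)
    finally have "root_hom n f t (form_zeta n f 1) = \<dots>" .
    then show ?thesis using assms by (simp add: basis_val_def zeta_val_def)
  qed
  from this[of \<theta>] this[of \<theta>'] show "\<theta> = \<theta>'" using assms eq by simp
qed

text \<open>Turns the sum over homomorphisms into a sum over roots, where the analytic estimates
  take place; distinct roots give distinct homomorphisms.\<close>

lemma ring_length_form_ring:
  assumes "2 \<le> n" "f \<in> binary_forms n" "f 0 \<noteq> 0" "u \<in> carrier (form_ring n f)"
  shows "ring_length n (form_ring n f) u =
    sqrt (1 / real n * (\<Sum>\<theta> | poly (form_poly n f) \<theta> = 0.
      (cmod (\<Sum>k<n. of_int (u k) * basis_val f \<theta> k))\<^sup>2))"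
proof -
  have "(\<Sum>\<sigma>\<in>complex_homs (form_ring n f). (cmod (\<sigma> u))\<^sup>2)
      = (\<Sum>\<theta> | poly (form_poly n f) \<theta> = 0. (cmod (root_hom n f \<theta> u))\<^sup>2)"
    unfolding complex_homs_form_ring[OF assms(1-3)]
    by (subst sum.reindex) (auto intro: inj_on_subset[OF inj_root_hom] simp: assms)
  then show ?thesis using assms(4) by (simp add: ring_length_def root_hom_def)
qed

section \<open>The dual basis\<close>

text \<open>The quotient of f(x, 1) by x - \<theta> when \<theta> is a root, with coefficients as in
  synthetic division. They differ from the values of the zeta_k only by the integers f_k, whence a
  dual basis of Euler type.\<close>

definition form_cofactor :: "nat \<Rightarrow> (nat \<Rightarrow> int) \<Rightarrow> complex \<Rightarrow> complex poly" where
  "form_cofactor n f \<theta> = (\<Sum>k<n. monom (zeta_val f \<theta> k + of_int (f k)) (n - 1 - k))"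

lemma coeff_form_cofactor:
  assumes "k < n"
  shows "coeff (form_cofactor n f \<theta>) (n - 1 - k) = zeta_val f \<theta> k + of_int (f k)"
proof -
  have "coeff (form_cofactor n f \<theta>) (n - 1 - k)
      = (\<Sum>i<n. if i = k then zeta_val f \<theta> i + of_int (f i) else 0)"
    unfolding form_cofactor_def coeff_sum using assms by (intro sum.cong) auto
  then show ?thesis using assms by simp
qed

lemma degree_form_cofactor: "0 < n \<Longrightarrow> degree (form_cofactor n f \<theta>) < n"
  unfolding form_cofactor_def
  by (intro degree_sum_less) (auto intro: le_less_trans[OF degree_monom_le])

lemma form_poly_eq_cofactor_mult:
  assumes root: "poly (form_poly n f) \<theta> = 0"
  shows "form_poly n f = [:- \<theta>, 1:] * form_cofactor n f \<theta>"
proof -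
  \<comment> \<open>Synthetic division after m steps; the remainder is
    \<open>zeta_val f \<theta> m * x ^ (n - m)\<close>, and for m = n it equals -f_n at a
    root.\<close>
  have partial: "(x - \<theta>) * (\<Sum>k<m. (zeta_val f \<theta> k + of_int (f k)) * x ^ (n - 1 - k))
      = (\<Sum>k<m. of_int (f k) * x ^ (n - k)) - zeta_val f \<theta> m * x ^ (n - m)" if "m \<le> n" for m x
    using that
  proof (induction m)
    case (Suc m)
    have "x ^ (n - m) = x * x ^ (n - 1 - m)"
      using Suc.prems by (simp add: power_Suc[symmetric] Suc_diff_Suc del: power_Suc)
    with Suc show ?case by (simp add: zeta_val_Suc algebra_simps)
  qed simp
  have "poly (form_poly n f) x = poly ([:- \<theta>, 1:] * form_cofactor n f \<theta>) x" for x
  proof -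
    have "poly ([:- \<theta>, 1:] * form_cofactor n f \<theta>) x
        = (x - \<theta>) * (\<Sum>k<n. (zeta_val f \<theta> k + of_int (f k)) * x ^ (n - 1 - k))"
      by (simp add: form_cofactor_def poly_sum poly_monom left_diff_distrib)
    also have "\<dots> = (\<Sum>k<n. of_int (f k) * x ^ (n - k)) + of_int (f n)"
      using partial[of n x] root by (simp add: poly_form_poly_zeta_val add_eq_0_iff2)
    also have "\<dots> = poly (form_poly n f) x"
      by (simp add: poly_form_poly flip: lessThan_Suc_atMost)
    finally show ?thesis by simp
  qed
  then show ?thesis by (simp add: poly_eq_poly_eq_iff[symmetric] fun_eq_iff)
qed

lemma poly_form_cofactor_self:
  assumes "poly (form_poly n f) \<theta> = 0"
  shows "poly (form_cofactor n f \<theta>) \<theta> = poly (pderiv (form_poly n f)) \<theta>"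
  by (subst form_poly_eq_cofactor_mult[OF assms], simp only: pderiv_mult poly_add poly_mult)
    (simp add: pderiv_pCons)

lemma poly_form_cofactor_other:
  assumes "poly (form_poly n f) \<theta> = 0" "poly (form_poly n f) \<theta>' = 0" "\<theta>' \<noteq> \<theta>"
  shows "poly (form_cofactor n f \<theta>) \<theta>' = 0"
  using assms(2,3) by (subst (asm) form_poly_eq_cofactor_mult[OF assms(1)]) auto

section \<open>Simple roots and recovery of coordinates\<close>

lemma degree_form_poly:
  assumes "f 0 \<noteq> 0"
  shows "degree (form_poly n f) = n"
proof (rule antisym)
  show "degree (form_poly n f) \<le> n"
    unfolding form_poly_def by (intro degree_sum_le) (auto intro: order.trans[OF degree_monom_le])
  have "coeff (form_poly n f) n = (\<Sum>i\<le>n. if i = 0 then of_int (f i) else 0)"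
    unfolding form_poly_def coeff_sum by (intro sum.cong) auto
  then show "n \<le> degree (form_poly n f)"
    using assms by (intro le_degree) simp
qed

lemma card_roots_form_poly:
  assumes "0 < n" "f 0 \<noteq> 0"
    and simple: "\<And>\<theta>. poly (form_poly n f) \<theta> = 0 \<Longrightarrow> poly (pderiv (form_poly n f)) \<theta> \<noteq> 0"
  shows "card {\<theta>. poly (form_poly n f) \<theta> = 0} = n"
proof -
  have "form_poly n f \<noteq> 0" using degree_form_poly[of f n] assms by auto
  moreover have "rsquarefree (form_poly n f)"
    using simple by (auto simp: rsquarefree_roots)
  ultimately show ?thesis
    using rsquarefree_card_degree[of "form_poly n f"] degree_form_poly[of f n] assms by simp
qed

text \<open>Compare coefficients in the Lagrange interpolation of \<open>x\<^sup>e\<close> at the roots.\<close>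

lemma sum_roots_dual:
  assumes n: "0 < n" and f0: "f 0 \<noteq> 0"
    and simple: "\<And>\<theta>. poly (form_poly n f) \<theta> = 0 \<Longrightarrow> poly (pderiv (form_poly n f)) \<theta> \<noteq> 0"
    and ek: "e < n" "k < n"
  shows "(\<Sum>\<theta> | poly (form_poly n f) \<theta> = 0. \<theta> ^ e / poly (pderiv (form_poly n f)) \<theta>
      * (zeta_val f \<theta> k + of_int (f k))) = (if e = n - 1 - k then 1 else 0)"
proof -
  let ?Z = "{\<theta>. poly (form_poly n f) \<theta> = 0}"
  let ?w = "\<lambda>\<theta>. \<theta> ^ e / poly (pderiv (form_poly n f)) \<theta>"
  let ?L = "\<Sum>\<theta>\<in>?Z. Polynomial.smult (?w \<theta>) (form_cofactor n f \<theta>)"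
  have card: "card ?Z = n" by (rule card_roots_form_poly[OF n f0 simple])
  then have fin: "finite ?Z" using n card.infinite by fastforce
  have "?L = monom 1 e"
  proof (rule poly_eqI_degree)
    fix x assume x: "x \<in> ?Z"
    have "poly ?L x = (\<Sum>\<theta>\<in>?Z. if \<theta> = x then x ^ e else 0)"
      unfolding poly_sum using x simple
      by (intro sum.cong) (auto simp: poly_form_cofactor_self poly_form_cofactor_other)
    then show "poly ?L x = poly (monom 1 e) x"
      using x fin by (simp add: poly_monom)
  next
    show "degree ?L < card ?Z"
      unfolding card using n degree_form_cofactor
      by (intro degree_sum_less) (auto intro: le_less_trans[OF degree_smult_le])
    show "degree (monom (1::complex) e) < card ?Z"
      unfolding card using ek by (simp add: degree_monom_eq)
  qed
  then have "coeff ?L (n - 1 - k) = (if e = n - 1 - k then 1 else 0)" by simp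
  then show ?thesis using coeff_form_cofactor[OF ek(2)] by (simp add: coeff_sum)
qed

text \<open>The dual relations concern zeta_k + f_k rather than zeta_k. For m > 0 the weights have
  sum 0, so the constants f_k and the coordinate at zeta_0 drop out.\<close>

lemma coordinate_eq_sum_roots:
  assumes n: "0 < n" and f0: "f 0 \<noteq> 0"
    and simple: "\<And>\<theta>. poly (form_poly n f) \<theta> = 0 \<Longrightarrow> poly (pderiv (form_poly n f)) \<theta> \<noteq> 0"
    and m: "0 < m" "m < n"
  shows "of_int (u m) = (\<Sum>\<theta> | poly (form_poly n f) \<theta> = 0.
      \<theta> ^ (n - 1 - m) / poly (pderiv (form_poly n f)) \<theta> * (\<Sum>k<n. of_int (u k) * basis_val f \<theta> k))"
proof -
  let ?Z = "{\<theta>. poly (form_poly n f) \<theta> = 0}"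
  let ?w = "\<lambda>\<theta>. \<theta> ^ (n - 1 - m) / poly (pderiv (form_poly n f)) \<theta>"
  have dual: "(\<Sum>\<theta>\<in>?Z. ?w \<theta> * (zeta_val f \<theta> k + of_int (f k))) = (if k = m then 1 else 0)"
    if "k < n" for k
    using sum_roots_dual[OF n f0 simple, of "n - 1 - m" k] m that by auto
  \<comment> \<open>The dual relation for k = 0, where zeta_val is 0 and only the constant f_0
    remains.\<close>
  have "(\<Sum>\<theta>\<in>?Z. ?w \<theta>) * of_int (f 0) = 0"
    using dual[of 0] m unfolding sum_distrib_right by simp
  then have trace: "(\<Sum>\<theta>\<in>?Z. ?w \<theta>) = 0"
    using f0 by (simp only: mult_eq_0_iff of_int_eq_0_iff simp_thms)
  \<comment> \<open>Replaces zeta_k by zeta_k + f_k and collects the corrections in a term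
    independent of \<theta>, which the vanishing sum of weights then kills.\<close>
  have expand: "(\<Sum>k<n. of_int (u k) * basis_val f \<theta> k)
      = (\<Sum>k=1..<n. of_int (u k) * (zeta_val f \<theta> k + of_int (f k)))
        + (of_int (u 0) - (\<Sum>k=1..<n. of_int (u k) * of_int (f k)))" for \<theta>
  proof -
    have "(\<Sum>k<n. of_int (u k) * basis_val f \<theta> k)
        = of_int (u 0) + (\<Sum>k=1..<n. of_int (u k) * basis_val f \<theta> k)"
      using n by (simp add: lessThan_atLeast0 sum.atLeast_Suc_lessThan basis_val_def)
    also have "(\<Sum>k=1..<n. of_int (u k) * basis_val f \<theta> k) = (\<Sum>k=1..<n. of_int (u k) * zeta_val f \<theta> k)"
      by (intro sum.cong) (auto simp: basis_val_def)
    finally show ?thesis by (simp add: algebra_simps sum.distrib)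
  qed
  have "?w \<theta> * (\<Sum>k<n. of_int (u k) * basis_val f \<theta> k)
      = (\<Sum>k=1..<n. of_int (u k) * (?w \<theta> * (zeta_val f \<theta> k + of_int (f k))))
        + ?w \<theta> * (of_int (u 0) - (\<Sum>k=1..<n. of_int (u k) * of_int (f k)))" for \<theta>
    unfolding expand distrib_left[of "?w \<theta>" "sum _ _"]
    by (simp only: sum_distrib_left mult.left_commute)
  then have "(\<Sum>\<theta>\<in>?Z. ?w \<theta> * (\<Sum>k<n. of_int (u k) * basis_val f \<theta> k))
      = (\<Sum>\<theta>\<in>?Z. \<Sum>k=1..<n. of_int (u k) * (?w \<theta> * (zeta_val f \<theta> k + of_int (f k))))
        + (\<Sum>\<theta>\<in>?Z. ?w \<theta>) * (of_int (u 0) - (\<Sum>k=1..<n. of_int (u k) * of_int (f k)))"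
    by (simp only: sum.distrib sum_distrib_right)
  also have "\<dots> = (\<Sum>k=1..<n. of_int (u k) * (\<Sum>\<theta>\<in>?Z. ?w \<theta> * (zeta_val f \<theta> k + of_int (f k))))"
    unfolding trace by (subst sum.swap) (simp add: sum_distrib_left)
  also have "\<dots> = (\<Sum>k=1..<n. if k = m then of_int (u k) else 0)"
  proof (rule sum.cong[OF refl])
    fix k assume "k \<in> {1..<n}"
    then have "k < n" by simp
    show "of_int (u k) * (\<Sum>\<theta>\<in>?Z. ?w \<theta> * (zeta_val f \<theta> k + of_int (f k))) = (if k = m then of_int (u k) else 0)"
      unfolding dual[OF \<open>k < n\<close>] by simp
  qed
  finally show ?thesis using m by simp
qed

section \<open>Linear independence in the ring\<close>

text \<open>Gaussian elimination without division: a vector \<open>v j0\<close> with nonzero last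
  coordinate is the pivot, and the others are cross-multiplied with it, which keeps all entries
  integral and removes that coordinate.\<close>

lemma int_vectors_dependent:
  fixes v :: "'a \<Rightarrow> nat \<Rightarrow> int"
  assumes "finite J" "card J > m" "\<And>j k. j \<in> J \<Longrightarrow> k \<ge> m \<Longrightarrow> v j k = 0"
  shows "\<exists>c. (\<exists>j\<in>J. c j \<noteq> 0) \<and> (\<forall>k. (\<Sum>j\<in>J. c j * v j k) = 0)"
  using assms
proof (induction m arbitrary: J v)
  case 0
  then have "J \<noteq> {}" by auto
  with 0 show ?case by (intro exI[of _ "\<lambda>_. 1"]) auto
next
  case (Suc m)
  show ?case
  proof (cases "\<forall>j\<in>J. v j m = 0")
    case True
    have "v j k = 0" if "j \<in> J" "k \<ge> m" for j k
      using True Suc.prems(3)[of j k] that by (cases "k = m") auto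
    then show ?thesis using Suc.IH[of J v] Suc.prems by auto
  next
    case False
    then obtain j0 where j0: "j0 \<in> J" "v j0 m \<noteq> 0" by auto
    define J' where "J' = J - {j0}"
    define w where "w j k = v j0 m * v j k - v j m * v j0 k" for j k
    have J: "J = insert j0 J'" "j0 \<notin> J'" "finite J'"
      using j0 Suc.prems(1) by (auto simp: J'_def)
    have "w j k = 0" if "j \<in> J'" "k \<ge> m" for j k
      using Suc.prems(3)[of j k] Suc.prems(3)[of j0 k] that j0 J by (cases "k = m") (auto simp: w_def)
    moreover have "card J' > m" using Suc.prems(2) J by simp
    ultimately obtain c where c: "\<exists>j\<in>J'. c j \<noteq> 0" "\<And>k. (\<Sum>j\<in>J'. c j * w j k) = 0"
      using Suc.IH[of J' w] J(3) by auto
    \<comment> \<open>Undoes the elimination: the pivot receives the total that was subtracted, and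
      the other coefficients pick up the pivot entry.\<close>
    define c' where "c' j = (if j = j0 then - (\<Sum>j\<in>J'. c j * v j m) else v j0 m * c j)" for j
    have "(\<Sum>j\<in>J. c' j * v j k) = 0" for k
    proof -
      have "(\<Sum>j\<in>J'. c' j * v j k) = (\<Sum>j\<in>J'. v j0 m * c j * v j k)"
        using J(2) by (intro sum.cong) (auto simp: c'_def)
      then have "(\<Sum>j\<in>J. c' j * v j k) = (\<Sum>j\<in>J'. c j * w j k)"
        using J(2,3) unfolding J(1)
        by (simp add: c'_def w_def algebra_simps sum_subtractf sum_distrib_left sum_distrib_right)
      then show ?thesis using c(2) by simp
    qed
    moreover have "\<exists>j\<in>J. c' j \<noteq> 0"
      using c(1) j0 J by (auto simp: c'_def)
    ultimately show ?thesis by blast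
  qed
qed

section \<open>The additive group of the ring in coordinates\<close>

lemma abelian_group_form_ring: "abelian_group (form_ring n f)"
proof (rule abelian_groupI)
  fix u assume "u \<in> carrier (form_ring n f)"
  then show "\<exists>v\<in>carrier (form_ring n f). v \<oplus>\<^bsub>form_ring n f\<^esub> u = \<zero>\<^bsub>form_ring n f\<^esub>"
    by (intro bexI[of _ "\<lambda>m. - u m"]) auto
qed (auto simp: algebra_simps)

lemma add_pow_form_ring:
  fixes c :: int
  assumes u: "u \<in> carrier (form_ring n f)"
  shows "[c] \<cdot>\<^bsub>form_ring n f\<^esub> u = (\<lambda>m. c * u m)"
proof -
  interpret abelian_group "form_ring n f" by (rule abelian_group_form_ring)
  show ?thesis
  proof (induction c rule: int_induct[where k = 0])
    case base
    then show ?case by (simp add: add_pow_def)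
  next
    case (step1 i)
    have "[(i + 1)] \<cdot>\<^bsub>form_ring n f\<^esub> u = [i] \<cdot>\<^bsub>form_ring n f\<^esub> u \<oplus>\<^bsub>form_ring n f\<^esub> [(1::int)] \<cdot>\<^bsub>form_ring n f\<^esub> u"
      by (rule add.int_pow_mult[OF u])
    also have "[(1::int)] \<cdot>\<^bsub>form_ring n f\<^esub> u = u"
      by (rule add.int_pow_1[OF u])
    finally show ?case using step1 by (simp add: algebra_simps)
  next
    case (step2 i)
    have "[i] \<cdot>\<^bsub>form_ring n f\<^esub> u = [(i - 1)] \<cdot>\<^bsub>form_ring n f\<^esub> u \<oplus>\<^bsub>form_ring n f\<^esub> [(1::int)] \<cdot>\<^bsub>form_ring n f\<^esub> u"
      using add.int_pow_mult[OF u, of "i - 1" 1] by simp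
    also have "[(1::int)] \<cdot>\<^bsub>form_ring n f\<^esub> u = u"
      by (rule add.int_pow_1[OF u])
    finally show ?case using step2 by (simp add: algebra_simps fun_eq_iff)
  qed
qed

lemma finsum_form_ring:
  assumes "finite J" "w \<in> J \<rightarrow> carrier (form_ring n f)"
  shows "(\<Oplus>\<^bsub>form_ring n f\<^esub>j\<in>J. w j) = (\<lambda>m. \<Sum>j\<in>J. w j m)"
proof -
  interpret abelian_group "form_ring n f" by (rule abelian_group_form_ring)
  show ?thesis using assms
  proof (induction J rule: finite_induct)
    case empty
    then show ?case by simp
  next
    case (insert j J)
    then show ?case by (subst finsum_insert) auto
  qed
qed

text \<open>Makes independence in the ring a statement about integer vectors, to which
  \<open>int_vectors_dependent\<close> applies.\<close>

lemma int_independent_form_ring_iff: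
  "int_independent (form_ring n f) k v \<longleftrightarrow> (\<forall>j<k. \<forall>m\<ge>n. v j m = 0) \<and>
     (\<forall>c :: nat \<Rightarrow> int. (\<forall>m. (\<Sum>j<k. c j * v j m) = 0) \<longrightarrow> (\<forall>j<k. c j = 0))"
proof -
  have "(\<Oplus>\<^bsub>form_ring n f\<^esub>j\<in>{..<k}. [c j] \<cdot>\<^bsub>form_ring n f\<^esub> v j) = (\<lambda>m. \<Sum>j<k. c j * v j m)"
    if v: "v \<in> {..<k} \<rightarrow> carrier (form_ring n f)" for c :: "nat \<Rightarrow> int"
  proof -
    interpret abelian_group "form_ring n f" by (rule abelian_group_form_ring)
    have "(\<Oplus>\<^bsub>form_ring n f\<^esub>j\<in>{..<k}. [c j] \<cdot>\<^bsub>form_ring n f\<^esub> v j)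
        = (\<Oplus>\<^bsub>form_ring n f\<^esub>j\<in>{..<k}. (\<lambda>m. c j * v j m))"
      using v by (intro finsum_cong') (auto simp: add_pow_form_ring Pi_iff)
    also have "\<dots> = (\<lambda>m. \<Sum>j<k. c j * v j m)"
      using v by (intro finsum_form_ring) (auto simp: Pi_iff)
    finally show ?thesis .
  qed
  then show ?thesis
    unfolding int_independent_def by (auto simp: Pi_iff fun_eq_iff)
qed

section \<open>Successive minima near \<open>x\<^sup>n + y\<^sup>n\<close>\<close>

text \<open>A LEAST over the reals says something only if a least radius exists. Any admissible
  radius can be lowered to the greatest length occurring in its family, and below a given radius
  only finitely many lengths occur.\<close>

lemma succ_min_attained:
  assumes fin: "\<And>r. finite {u \<in> carrier R. ring_length n R u \<le> r}"
    and indep: "int_independent R (i + 1) v"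
  shows "\<exists>v. int_independent R (i + 1) v \<and> (\<forall>j<i + 1. ring_length n R (v j) \<le> succ_min n R i)"
    and "\<And>w r. int_independent R (i + 1) w \<Longrightarrow> (\<And>j. j \<le> i \<Longrightarrow> ring_length n R (w j) \<le> r) \<Longrightarrow>
      succ_min n R i \<le> r"
proof -
  let ?len = "ring_length n R"
  define P where "P r \<longleftrightarrow> (\<exists>v. int_independent R (i + 1) v \<and> (\<forall>j<i + 1. ?len (v j) \<le> r))" for r
  define top where "top v = Max ((\<lambda>j. ?len (v j)) ` {..<i + 1})" for v
  have top: "?len (v j) \<le> top v" if "j < i + 1" for v j
    unfolding top_def using that by (intro Max_ge) auto
  have top_in: "\<exists>j<i + 1. top v = ?len (v j)" for v
  proof -
    have "top v \<in> (\<lambda>j. ?len (v j)) ` {..<i + 1}"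
      unfolding top_def by (rule Max_in) auto
    then show ?thesis by blast
  qed
  define r0 where "r0 = top v"
  have P0: "P r0" using indep top unfolding P_def r0_def by blast
  \<comment> \<open>The admissible radii that are themselves lengths and do not exceed r0; the
    minimum of this finite set is the successive minimum.\<close>
  define S where "S = {r \<in> ?len ` {u \<in> carrier R. ?len u \<le> r0}. P r}"
  have finS: "finite S" unfolding S_def using fin[of r0] by simp
  have below0: "\<exists>r'\<in>S. r' \<le> r" if Pr: "P r" and r: "r \<le> r0" for r
  proof -
    obtain w where w: "int_independent R (i + 1) w" "\<forall>j<i + 1. ?len (w j) \<le> r"
      using Pr unfolding P_def by blast
    obtain j where j: "j < i + 1" "top w = ?len (w j)" using top_in by blast
    have "w j \<in> carrier R" using w(1) j(1) unfolding int_independent_def by auto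
    moreover have "P (top w)" using w(1) top unfolding P_def by blast
    moreover have "?len (w j) \<le> r" using w(2) j(1) by blast
    ultimately have "top w \<in> S" using j r unfolding S_def by auto
    then show ?thesis using j \<open>?len (w j) \<le> r\<close> by auto
  qed
  have below: "\<exists>r'\<in>S. r' \<le> r" if "P r" for r
  proof (cases "r \<le> r0")
    case False
    obtain r' where "r' \<in> S" "r' \<le> r0" using below0[OF P0] by auto
    with False show ?thesis by (intro bexI[of _ r']) auto
  qed (use below0[OF that] in simp)
  have S0: "S \<noteq> {}" using below[OF P0] by auto
  have least: "Min S \<le> r" if "P r" for r
    using below[OF that] finS by (meson Min_le order.trans)
  have PMin: "P (Min S)" using Min_in[OF finS S0] unfolding S_def by blast
  have eq: "succ_min n R i = Min S"
    unfolding succ_min_def using PMin least unfolding P_def by (intro Least_equality) auto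
  show "\<exists>v. int_independent R (i + 1) v \<and> (\<forall>j<i + 1. ?len (v j) \<le> succ_min n R i)"
    using PMin unfolding P_def eq .
  show "succ_min n R i \<le> r" if "int_independent R (i + 1) w" "\<And>j. j \<le> i \<Longrightarrow> ?len (w j) \<le> r" for w r
    unfolding eq using that by (intro least) (auto simp: P_def)
qed

text \<open>The coefficients of the model form \<open>x\<^sup>n + y\<^sup>n\<close>.\<close>

definition fermat_coeff :: "nat \<Rightarrow> nat \<Rightarrow> real" where
  "fermat_coeff n i = (if i = 0 \<or> i = n then 1 else 0)"

definition near_forms :: "nat \<Rightarrow> real \<Rightarrow> real \<Rightarrow> real \<Rightarrow> (nat \<Rightarrow> int) set" where
  "near_forms n \<delta> A B = {f \<in> binary_forms n.
     \<forall>i\<le>n. \<bar>real_of_int (f i) - A * B ^ i * fermat_coeff n i\<bar> \<le> \<delta> * (A * B ^ i)}"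

lemma cmod_of_int [simp]: "cmod (of_int k) = \<bar>of_int k\<bar>"
  by (metis norm_of_real of_real_of_int_eq)

text \<open>The bound on \<delta> is tuned to sums of n + 1 error terms, each enlarged by at most
  2^n through powers of a root of size at most 2 B: the total error stays within 1/8 of the main
  term.\<close>

locale near_form =
  fixes n :: nat and \<delta> A B :: real and f :: "nat \<Rightarrow> int"
  assumes n: "n \<ge> 2" and AB: "A > 0" "B > 0"
    and \<delta>: "0 \<le> \<delta>" "8 * (real n + 1) * 2 ^ n * \<delta> \<le> 1"
    and near: "f \<in> near_forms n \<delta> A B"
begin

lemma form: "f \<in> binary_forms n"
  using near by (simp add: near_forms_def)

lemma delta_small: "(real n + 1) * 2 ^ n * \<delta> \<le> 1 / 8" "\<delta> \<le> 1 / 8"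
proof -
  show *: "(real n + 1) * 2 ^ n * \<delta> \<le> 1 / 8"
  proof -
    have "8 * ((real n + 1) * 2 ^ n * \<delta>) \<le> 1" using \<delta>(2) by (simp only: mult.assoc)
    then show ?thesis by linarith
  qed
  have "1 * 1 \<le> (real n + 1) * 2 ^ n" by (intro mult_mono) auto
  then have "1 * \<delta> \<le> (real n + 1) * 2 ^ n * \<delta>" using \<delta>(1) by (intro mult_right_mono) auto
  then show "\<delta> \<le> 1 / 8" using * by simp
qed

lemma delta_linear_small: "(real n + 1) * \<delta> \<le> 1 / 8"
proof -
  have "(real n + 1) * \<delta> * 1 \<le> (real n + 1) * \<delta> * 2 ^ n"
    using \<delta> by (intro mult_left_mono) auto
  also have "\<dots> = (real n + 1) * 2 ^ n * \<delta>" by (simp only: mult_ac)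
  also note delta_small(1)
  finally show ?thesis by simp
qed

lemma error: "i \<le> n \<Longrightarrow> \<bar>real_of_int (f i) - A * B ^ i * fermat_coeff n i\<bar> \<le> \<delta> * (A * B ^ i)"
  using near by (simp add: near_forms_def)

lemma coeff_bound: "i \<le> n \<Longrightarrow> \<bar>real_of_int (f i)\<bar> \<le> 2 * (A * B ^ i)"
proof -
  assume i: "i \<le> n"
  have pos: "A * B ^ i > 0" using AB by simp
  have small: "\<delta> * (A * B ^ i) \<le> 1 * (A * B ^ i)"
    using delta_small AB by (intro mult_right_mono) auto
  have "A * B ^ i * fermat_coeff n i = 0 \<or> A * B ^ i * fermat_coeff n i = A * B ^ i"
    by (auto simp: fermat_coeff_def)
  then show ?thesis
  proof
    assume "A * B ^ i * fermat_coeff n i = 0"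
    with error[OF i] pos small show ?thesis by linarith
  next
    assume "A * B ^ i * fermat_coeff n i = A * B ^ i"
    with error[OF i] pos small show ?thesis by linarith
  qed
qed

lemma f0: "f 0 \<noteq> 0"
proof
  assume "f 0 = 0"
  then have "A \<le> \<delta> * A" using error[of 0] AB by (simp add: fermat_coeff_def)
  then show False using AB delta_small by (simp add: mult_le_cancel_right1)
qed

text \<open>At a root, \<theta>^n differs from -B^n only by the coefficient errors. With s =
  |\<theta>| / B this reads |s^n - 1| <= (n + 1) \<delta> max(1, s)^n.\<close>

lemma root_size:
  assumes "poly (form_poly n f) \<theta> = 0"
  shows "cmod \<theta> \<le> 2 * B" "7 / 8 * B ^ n \<le> cmod \<theta> ^ n"
proof -
  define s where "s = cmod \<theta> / B"
  have s: "s \<ge> 0" "cmod \<theta> = s * B" using AB by (auto simp: s_def)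
  define E where "E i = real_of_int (f i) - A * B ^ i * fermat_coeff n i" for i
  have "0 = (\<Sum>i\<le>n. complex_of_real (A * B ^ i * fermat_coeff n i) * \<theta> ^ (n - i))
      + (\<Sum>i\<le>n. complex_of_real (E i) * \<theta> ^ (n - i))"
    using assms by (simp add: poly_form_poly E_def algebra_simps flip: sum.distrib)
  also have "(\<Sum>i\<le>n. complex_of_real (A * B ^ i * fermat_coeff n i) * \<theta> ^ (n - i))
      = (\<Sum>i\<in>{0, n}. complex_of_real (A * B ^ i) * \<theta> ^ (n - i))"
    by (intro sum.mono_neutral_cong_right) (auto simp: fermat_coeff_def)
  also have "\<dots> = A * (\<theta> ^ n + of_real (B ^ n))"
    using n by (simp add: algebra_simps)
  finally have "cmod (A * (\<theta> ^ n + of_real (B ^ n))) = cmod (\<Sum>i\<le>n. complex_of_real (E i) * \<theta> ^ (n - i))"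
    by (metis add_eq_0_iff norm_minus_cancel)
  also have "\<dots> \<le> (\<Sum>i\<le>n. \<delta> * (A * B ^ n) * max 1 s ^ n)"
  proof (rule sum_norm_le)
    fix i assume "i \<in> {..n}"
    then have i: "i \<le> n" by simp
    have "cmod (complex_of_real (E i) * \<theta> ^ (n - i)) = \<bar>E i\<bar> * (s * B) ^ (n - i)"
      by (simp add: norm_mult norm_power s)
    also have "\<dots> \<le> \<delta> * (A * B ^ i) * (s * B) ^ (n - i)"
      using error[OF i] s AB by (intro mult_right_mono) (auto simp: E_def)
    also have "\<dots> = \<delta> * (A * B ^ n) * s ^ (n - i)"
      using i by (simp add: power_mult_distrib mult_ac flip: power_add)
    also have "s ^ (n - i) \<le> max 1 s ^ (n - i)" using s by (intro power_mono) auto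
    also have "max 1 s ^ (n - i) \<le> max 1 s ^ n" by (intro power_increasing) auto
    finally show "cmod (complex_of_real (E i) * \<theta> ^ (n - i)) \<le> \<delta> * (A * B ^ n) * max 1 s ^ n"
      using \<delta> AB by (simp add: mult_left_mono)
  qed
  also have "\<dots> = A * B ^ n * ((real n + 1) * \<delta> * max 1 s ^ n)"
    by (simp add: algebra_simps)
  finally have "A * cmod (\<theta> ^ n + of_real (B ^ n)) \<le> A * B ^ n * ((real n + 1) * \<delta> * max 1 s ^ n)"
    using AB by (simp add: norm_mult)
  then have up: "cmod (\<theta> ^ n + of_real (B ^ n)) \<le> B ^ n * ((real n + 1) * \<delta> * max 1 s ^ n)"
    using AB by (simp add: mult.assoc)
  have "\<bar>cmod (\<theta> ^ n) - cmod (of_real (B ^ n))\<bar> \<le> cmod (\<theta> ^ n + of_real (B ^ n))"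
    using norm_triangle_ineq3[of "\<theta> ^ n" "- of_real (B ^ n)"] by simp
  also have "\<bar>cmod (\<theta> ^ n) - cmod (of_real (B ^ n))\<bar> = B ^ n * \<bar>s ^ n - 1\<bar>"
  proof -
    have "cmod (\<theta> ^ n) - cmod (of_real (B ^ n)) = B ^ n * (s ^ n - 1)"
      using AB by (simp add: norm_power s power_mult_distrib algebra_simps)
    then show ?thesis using AB by (simp add: abs_mult)
  qed
  finally have "B ^ n * \<bar>s ^ n - 1\<bar> \<le> B ^ n * ((real n + 1) * \<delta> * max 1 s ^ n)"
    using up by linarith
  then have key: "\<bar>s ^ n - 1\<bar> \<le> (real n + 1) * \<delta> * max 1 s ^ n"
    using AB by simp
  \<comment> \<open>For s > 2 the estimate would give (7/8) s^n <= 1, although s^n >= s > 2.\<close>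
  have s2: "s \<le> 2"
  proof (rule ccontr)
    assume "\<not> s \<le> 2"
    then have s2: "s > 2" by simp
    then have "s ^ 1 \<le> s ^ n" using n by (intro power_increasing) auto
    moreover have "s ^ n - 1 \<le> 1 / 8 * s ^ n"
    proof -
      have "(real n + 1) * \<delta> * s ^ n \<le> 1 / 8 * s ^ n"
        using delta_linear_small s2 by (intro mult_right_mono) auto
      moreover have "max 1 s = s" using s2 by simp
      ultimately have "(real n + 1) * \<delta> * max 1 s ^ n \<le> 1 / 8 * s ^ n" by simp
      then show ?thesis using key by linarith
    qed
    ultimately show False using s2 by simp
  qed
  then show "cmod \<theta> \<le> 2 * B" using s AB by simp
  have "(real n + 1) * \<delta> * max 1 s ^ n \<le> (real n + 1) * \<delta> * 2 ^ n"
    using s2 \<delta> by (intro mult_left_mono power_mono) auto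
  also have "\<dots> = (real n + 1) * 2 ^ n * \<delta>" by (simp only: mult_ac)
  also note delta_small(1)
  finally have "7 / 8 \<le> s ^ n" using key by linarith
  then have "7 / 8 * B ^ n \<le> s ^ n * B ^ n" using AB by (intro mult_right_mono) auto
  then show "7 / 8 * B ^ n \<le> cmod \<theta> ^ n" by (simp add: s power_mult_distrib)
qed

text \<open>The derivative is dominated by n A \<theta>^(n-1), of size at least 7/16 n A B^(n-1),
  while the errors contribute at most 1/8 n A B^(n-1).\<close>

lemma deriv_at_root:
  assumes root: "poly (form_poly n f) \<theta> = 0"
  shows "real n / 4 * (A * B ^ (n - 1)) \<le> cmod (poly (pderiv (form_poly n f)) \<theta>)"
proof -
  define E where "E i = real_of_int (f i) - A * B ^ i * fermat_coeff n i" for i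
  have deriv: "poly (pderiv (form_poly n f)) \<theta>
      = (\<Sum>i\<le>n. of_nat (n - i) * of_int (f i) * \<theta> ^ (n - i - 1))"
    unfolding form_poly_def by (simp add: higher_pderiv_sum pderiv_sum pderiv_monom poly_sum poly_monom)
  also have "\<dots> = (\<Sum>i\<le>n. of_nat (n - i) * complex_of_real (A * B ^ i * fermat_coeff n i) * \<theta> ^ (n - i - 1))
      + (\<Sum>i\<le>n. of_nat (n - i) * complex_of_real (E i) * \<theta> ^ (n - i - 1))"
    by (simp add: E_def algebra_simps flip: sum.distrib)
  also have "(\<Sum>i\<le>n. of_nat (n - i) * complex_of_real (A * B ^ i * fermat_coeff n i) * \<theta> ^ (n - i - 1))
      = (\<Sum>i\<in>{0}. of_nat (n - i) * complex_of_real (A * B ^ i) * \<theta> ^ (n - i - 1))"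
    by (intro sum.mono_neutral_cong_right) (auto simp: fermat_coeff_def)
  finally have split: "poly (pderiv (form_poly n f)) \<theta> = of_real (real n * A) * \<theta> ^ (n - 1)
      + (\<Sum>i\<le>n. of_nat (n - i) * complex_of_real (E i) * \<theta> ^ (n - i - 1))"
    by simp
  have "cmod (\<Sum>i\<le>n. of_nat (n - i) * complex_of_real (E i) * \<theta> ^ (n - i - 1))
      \<le> (\<Sum>i\<le>n. real n * \<delta> * 2 ^ n * (A * B ^ (n - 1)))"
  proof (rule sum_norm_le)
    fix i assume "i \<in> {..n}"
    then consider "i = n" | "i < n" by fastforce
    then show "cmod (of_nat (n - i) * complex_of_real (E i) * \<theta> ^ (n - i - 1))
        \<le> real n * \<delta> * 2 ^ n * (A * B ^ (n - 1))"
    proof cases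
      case 1
      then show ?thesis using \<delta> AB by simp
    next
      case 2
      have "cmod (of_nat (n - i) * complex_of_real (E i) * \<theta> ^ (n - i - 1))
          = real (n - i) * \<bar>E i\<bar> * cmod \<theta> ^ (n - i - 1)"
        by (simp add: norm_mult norm_power)
      also have "\<dots> \<le> real n * (\<delta> * (A * B ^ i)) * (2 * B) ^ (n - i - 1)"
        using error[of i] 2 root_size[OF root] \<delta> AB
        by (intro mult_mono power_mono) (auto simp: E_def)
      also have "\<dots> = real n * \<delta> * 2 ^ (n - i - 1) * (A * (B ^ i * B ^ (n - i - 1)))"
        by (simp add: power_mult_distrib)
      also have "B ^ i * B ^ (n - i - 1) = B ^ (n - 1)"
        using 2 by (simp flip: power_add)
      also have "(2::real) ^ (n - i - 1) \<le> 2 ^ n" by (intro power_increasing) auto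
      finally show ?thesis using \<delta> AB by (simp add: mult_left_mono mult_right_mono)
    qed
  qed
  also have "\<dots> = real n * (A * B ^ (n - 1)) * ((real n + 1) * 2 ^ n * \<delta>)"
    by (simp add: algebra_simps)
  also have "\<dots> \<le> real n * (A * B ^ (n - 1)) * (1 / 8)"
    using delta_small AB by (intro mult_left_mono) auto
  finally have rest: "cmod (\<Sum>i\<le>n. of_nat (n - i) * complex_of_real (E i) * \<theta> ^ (n - i - 1))
      \<le> real n / 8 * (A * B ^ (n - 1))" by simp
  \<comment> \<open>The lower bound for |\<theta>|^n is divided by |\<theta>| <= 2 B, which avoids
    extracting n-th roots.\<close>
  have "7 / 8 * (B * B ^ (n - 1)) \<le> cmod \<theta> * cmod \<theta> ^ (n - 1)"
    using root_size(2)[OF root] n by (simp flip: power_Suc)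
  also have "\<dots> \<le> 2 * B * cmod \<theta> ^ (n - 1)"
    using root_size(1)[OF root] by (intro mult_right_mono) auto
  finally have "B * (7 / 8 * B ^ (n - 1)) \<le> B * (2 * cmod \<theta> ^ (n - 1))" by simp
  then have "7 / 16 * B ^ (n - 1) \<le> cmod \<theta> ^ (n - 1)" using AB by simp
  then have "real n * A * (7 / 16 * B ^ (n - 1)) \<le> real n * A * cmod \<theta> ^ (n - 1)"
    using AB by (intro mult_left_mono) auto
  also have "\<dots> = cmod (of_real (real n * A) * \<theta> ^ (n - 1))"
    using AB by (simp only: norm_mult norm_power norm_of_real) simp
  finally have "7 / 16 * (real n * (A * B ^ (n - 1))) \<le> cmod (of_real (real n * A) * \<theta> ^ (n - 1))"
    by simp
  moreover have "cmod (of_real (real n * A) * \<theta> ^ (n - 1))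
      - cmod (\<Sum>i\<le>n. of_nat (n - i) * complex_of_real (E i) * \<theta> ^ (n - i - 1))
      \<le> cmod (poly (pderiv (form_poly n f)) \<theta>)"
    unfolding split by (rule norm_diff_ineq)
  moreover have "0 \<le> real n * (A * B ^ (n - 1))" using AB by simp
  ultimately show ?thesis using rest by simp
qed

lemma simple_roots:
  assumes "poly (form_poly n f) \<theta> = 0"
  shows "poly (pderiv (form_poly n f)) \<theta> \<noteq> 0"
proof
  assume "poly (pderiv (form_poly n f)) \<theta> = 0"
  then have "real n / 4 * (A * B ^ (n - 1)) \<le> 0" using deriv_at_root[OF assms] by simp
  moreover have "real n / 4 * (A * B ^ (n - 1)) > 0" using AB n by simp
  ultimately show False by simp
qed

lemma card_roots: "card {\<theta>. poly (form_poly n f) \<theta> = 0} = n"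
  using card_roots_form_poly[of n f] simple_roots n f0 by simp

lemma finite_roots: "finite {\<theta>. poly (form_poly n f) \<theta> = 0}"
  using card_roots n card.infinite by fastforce

text \<open>Each summand is at most 2 A B^m (2 B)^(k-m). The constant is chosen generously, to
  coincide with the one in \<open>coordinate_bound\<close>.\<close>

lemma zeta_val_bound:
  assumes root: "poly (form_poly n f) \<theta> = 0" and k: "k \<le> n"
  shows "cmod (zeta_val f \<theta> k) \<le> real n * 2 ^ (n + 2) * (A * B ^ k)"
proof -
  have "cmod (zeta_val f \<theta> k) \<le> (\<Sum>m<k. 2 ^ (n + 2) * (A * B ^ k))"
    unfolding zeta_val_def
  proof (rule sum_norm_le)
    fix m assume "m \<in> {..<k}"
    then have m: "m < k" by simp
    have "cmod (of_int (f m) * \<theta> ^ (k - m)) = \<bar>real_of_int (f m)\<bar> * cmod \<theta> ^ (k - m)"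
      by (simp add: norm_mult norm_power)
    also have "\<dots> \<le> 2 * (A * B ^ m) * (2 * B) ^ (k - m)"
      using coeff_bound[of m] root_size[OF root] m k AB by (intro mult_mono power_mono) auto
    also have "\<dots> = 2 ^ Suc (k - m) * (A * (B ^ m * B ^ (k - m)))"
      by (simp add: power_mult_distrib)
    also have "B ^ m * B ^ (k - m) = B ^ k" using m by (simp flip: power_add)
    also have "2 ^ Suc (k - m) * (A * B ^ k) \<le> 2 ^ (n + 2) * (A * B ^ k)"
      using AB k by (intro mult_right_mono power_increasing) auto
    finally show "cmod (of_int (f m) * \<theta> ^ (k - m)) \<le> 2 ^ (n + 2) * (A * B ^ k)" .
  qed
  also have "\<dots> = real k * (2 ^ (n + 2) * (A * B ^ k))" by simp
  also have "\<dots> \<le> real n * (2 ^ (n + 2) * (A * B ^ k))"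
    using k AB by (intro mult_right_mono) auto
  finally show ?thesis by simp
qed

section \<open>Comparison of lengths with coordinates\<close>

abbreviation len :: "(nat \<Rightarrow> int) \<Rightarrow> real" where
  "len \<equiv> ring_length n (form_ring n f)"

lemma len_le:
  assumes u: "u \<in> carrier (form_ring n f)" and K: "0 \<le> K"
    and bound: "\<And>\<theta>. poly (form_poly n f) \<theta> = 0 \<Longrightarrow> cmod (\<Sum>k<n. of_int (u k) * basis_val f \<theta> k) \<le> K"
  shows "len u \<le> K"
proof -
  have "(\<Sum>\<theta> | poly (form_poly n f) \<theta> = 0. (cmod (\<Sum>k<n. of_int (u k) * basis_val f \<theta> k))\<^sup>2)
      \<le> (\<Sum>\<theta> | poly (form_poly n f) \<theta> = 0. K\<^sup>2)"
    using bound by (intro sum_mono power_mono) auto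
  also have "\<dots> = real n * K\<^sup>2" by (simp add: card_roots)
  finally have "1 / real n * (\<Sum>\<theta> | poly (form_poly n f) \<theta> = 0. (cmod (\<Sum>k<n. of_int (u k) * basis_val f \<theta> k))\<^sup>2) \<le> K\<^sup>2"
    using n by (simp add: field_simps)
  then show ?thesis
    unfolding ring_length_form_ring[OF n form f0 u] using K by (simp add: real_le_lsqrt)
qed

lemma cmod_le_len:
  assumes u: "u \<in> carrier (form_ring n f)" and root: "poly (form_poly n f) \<theta> = 0"
  shows "cmod (\<Sum>k<n. of_int (u k) * basis_val f \<theta> k) \<le> real n * len u"
proof -
  let ?c = "\<lambda>\<theta>. cmod (\<Sum>k<n. of_int (u k) * basis_val f \<theta> k)"
  let ?S = "\<Sum>\<theta> | poly (form_poly n f) \<theta> = 0. (?c \<theta>)\<^sup>2"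
  have "(?c \<theta>)\<^sup>2 \<le> ?S"
    using root finite_roots by (intro member_le_sum) auto
  also have "?S = real n * (len u)\<^sup>2"
    unfolding ring_length_form_ring[OF n form f0 u] using n by (simp add: sum_nonneg)
  also have "\<dots> \<le> (real n * len u)\<^sup>2"
  proof -
    have "real n * 1 * (len u)\<^sup>2 \<le> real n * real n * (len u)\<^sup>2"
      using n by (intro mult_right_mono mult_left_mono) auto
    then show ?thesis by (simp add: power_mult_distrib power2_eq_square mult_ac)
  qed
  finally show ?thesis
  proof (rule power2_le_imp_le)
    show "0 \<le> real n * len u"
      unfolding ring_length_form_ring[OF n form f0 u] by (simp add: sum_nonneg)
  qed
qed

text \<open>The near orthogonality of the basis: the dual weight \<theta>^(n-1-m) / f'(\<theta>) has
  size at most of order B^(n-1-m) / (A B^(n-1)) = 1 / (A B^m), so a nonzero m-th coordinate forces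
  length of order A B^m.\<close>

lemma coordinate_bound:
  assumes u: "u \<in> carrier (form_ring n f)" and m: "0 < m" "m < n"
  shows "\<bar>real_of_int (u m)\<bar> * (A * B ^ m) \<le> real n * 2 ^ (n + 2) * len u"
proof -
  let ?Z = "{\<theta>. poly (form_poly n f) \<theta> = 0}"
  let ?c = "\<lambda>\<theta>. \<Sum>k<n. of_int (u k) * basis_val f \<theta> k"
  have pos: "A * B ^ m > 0" using AB by simp
  have n0: "0 < n" using n by simp
  have "\<bar>real_of_int (u m)\<bar> = cmod (of_int (u m))" by simp
  also have "\<dots> = cmod (\<Sum>\<theta>\<in>?Z. \<theta> ^ (n - 1 - m) / poly (pderiv (form_poly n f)) \<theta> * ?c \<theta>)"
    using coordinate_eq_sum_roots[OF n0 f0 simple_roots m, of u] by simp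
  also have "\<dots> \<le> (\<Sum>\<theta>\<in>?Z. 2 ^ (n + 2) * len u / (A * B ^ m))"
  proof (rule sum_norm_le)
    fix \<theta> assume "\<theta> \<in> ?Z"
    then have root: "poly (form_poly n f) \<theta> = 0" by simp
    have pos': "0 < real n / 4 * (A * B ^ (n - 1))" using AB n by simp
    have "cmod (\<theta> ^ (n - 1 - m) / poly (pderiv (form_poly n f)) \<theta> * ?c \<theta>)
        = cmod \<theta> ^ (n - 1 - m) / cmod (poly (pderiv (form_poly n f)) \<theta>) * cmod (?c \<theta>)"
      by (simp add: norm_mult norm_divide norm_power)
    also have "\<dots> \<le> (2 * B) ^ (n - 1 - m) / (real n / 4 * (A * B ^ (n - 1))) * (real n * len u)"
      using root_size[OF root] deriv_at_root[OF root] cmod_le_len[OF u root] pos' AB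
      by (intro mult_mono frac_le power_mono) auto
    also have "B ^ (n - 1) = B ^ m * B ^ (n - 1 - m)"
      using m by (simp flip: power_add)
    also have "(2 * B) ^ (n - 1 - m) / (real n / 4 * (A * (B ^ m * B ^ (n - 1 - m)))) * (real n * len u)
        = 2 ^ (n - 1 - m) * 4 * len u / (A * B ^ m)"
      using AB n by (simp add: power_mult_distrib field_simps)
    also have "\<dots> \<le> 2 ^ (n + 2) * len u / (A * B ^ m)"
    proof -
      have "(2::real) ^ (n - 1 - m) * 4 \<le> 2 ^ n * 4"
        by (intro mult_right_mono power_increasing) auto
      moreover have "0 \<le> len u"
        unfolding ring_length_form_ring[OF n form f0 u] by (simp add: sum_nonneg)
      ultimately show ?thesis using pos by (intro divide_right_mono mult_right_mono) (auto simp: mult.commute)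
    qed
    finally show "cmod (\<theta> ^ (n - 1 - m) / poly (pderiv (form_poly n f)) \<theta> * ?c \<theta>)
        \<le> 2 ^ (n + 2) * len u / (A * B ^ m)" .
  qed
  also have "\<dots> = real n * 2 ^ (n + 2) * len u / (A * B ^ m)"
    by (simp add: card_roots)
  finally show ?thesis using pos by (simp add: pos_le_divide_eq)
qed

text \<open>Coordinates with positive index are bounded by \<open>coordinate_bound\<close>.
  Coordinate 0 lies outside that bound and is recovered from the value at one root by subtracting
  the other terms.\<close>

lemma finite_short: "finite {u \<in> carrier (form_ring n f). len u \<le> r}"
proof -
  obtain \<theta> where root: "poly (form_poly n f) \<theta> = 0"
    using card_roots n by (metis (mono_tags, lifting) card.empty empty_Collect_eq not_numeral_le_zero)
  define D where "D m = real n * 2 ^ (n + 2) * r / (A * B ^ m)" for m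
  define K where "K = (\<Sum>m=1..<n. \<bar>D m\<bar>) + (real n * r + (\<Sum>m=1..<n. \<bar>D m\<bar> * cmod (basis_val f \<theta> m)))"
  have bound: "\<bar>real_of_int (u k)\<bar> \<le> \<bar>K\<bar>"
    if u: "u \<in> carrier (form_ring n f)" and len: "len u \<le> r" and k: "k < n" for u k
  proof -
    have "0 \<le> len u"
      unfolding ring_length_form_ring[OF n form f0 u] by (simp add: sum_nonneg)
    then have r: "0 \<le> r" using len by simp
    have D: "\<bar>real_of_int (u m)\<bar> \<le> \<bar>D m\<bar>" if m: "m \<in> {1..<n}" for m
    proof -
      have "\<bar>real_of_int (u m)\<bar> * (A * B ^ m) \<le> real n * 2 ^ (n + 2) * len u"
        using coordinate_bound[OF u, of m] m by simp
      also have "\<dots> \<le> real n * 2 ^ (n + 2) * r"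
        using len by (intro mult_left_mono) auto
      finally have "\<bar>real_of_int (u m)\<bar> \<le> D m"
        unfolding D_def using AB by (simp add: pos_le_divide_eq)
      then show ?thesis by simp
    qed
    show ?thesis
    proof (cases "k = 0")
      case True
      have "(\<Sum>k<n. of_int (u k) * basis_val f \<theta> k) = of_int (u 0) + (\<Sum>k=1..<n. of_int (u k) * basis_val f \<theta> k)"
        using n by (simp add: lessThan_atLeast0 sum.atLeast_Suc_lessThan basis_val_def)
      then have "cmod (of_int (u 0))
          = cmod ((\<Sum>k<n. of_int (u k) * basis_val f \<theta> k) - (\<Sum>k=1..<n. of_int (u k) * basis_val f \<theta> k))"
        by (simp only: add_diff_cancel_right')
      also have "\<dots> \<le> cmod (\<Sum>k<n. of_int (u k) * basis_val f \<theta> k) + cmod (\<Sum>k=1..<n. of_int (u k) * basis_val f \<theta> k)"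
        by (rule norm_triangle_ineq4)
      also have "\<dots> \<le> real n * len u + (\<Sum>m=1..<n. \<bar>D m\<bar> * cmod (basis_val f \<theta> m))"
        using D by (intro add_mono cmod_le_len[OF u root] sum_norm_le)
          (auto simp: norm_mult intro!: mult_right_mono)
      also have "\<dots> \<le> K"
        unfolding K_def using len by (simp add: sum_nonneg mult_left_mono add_increasing)
      finally show ?thesis using True by simp
    next
      case False
      then have "\<bar>D k\<bar> \<le> (\<Sum>m=1..<n. \<bar>D m\<bar>)" using k by (intro member_le_sum) auto
      also have "\<dots> \<le> K" unfolding K_def using r by (simp add: sum_nonneg)
      finally show ?thesis using D[of k] False k by simp
    qed
  qed
  have "finite {u. \<forall>k. (k \<in> {..<n} \<longrightarrow> u k \<in> {- \<lceil>\<bar>K\<bar>\<rceil>..\<lceil>\<bar>K\<bar>\<rceil>}) \<and> (k \<notin> {..<n} \<longrightarrow> u k = 0)}"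
    by (rule finite_set_of_finite_funs) auto
  moreover have "{u \<in> carrier (form_ring n f). len u \<le> r}
      \<subseteq> {u. \<forall>k. (k \<in> {..<n} \<longrightarrow> u k \<in> {- \<lceil>\<bar>K\<bar>\<rceil>..\<lceil>\<bar>K\<bar>\<rceil>}) \<and> (k \<notin> {..<n} \<longrightarrow> u k = 0)}"
  proof (intro subsetI CollectI allI conjI impI)
    fix u k assume u: "u \<in> {u \<in> carrier (form_ring n f). len u \<le> r}" and k: "k \<in> {..<n}"
    then have "\<bar>real_of_int (u k)\<bar> \<le> \<bar>K\<bar>" using bound by blast
    then show "u k \<in> {- \<lceil>\<bar>K\<bar>\<rceil>..\<lceil>\<bar>K\<bar>\<rceil>}" by (auto simp: abs_le_iff) linarith+
  qed auto
  ultimately show ?thesis by (rule finite_subset[rotated])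
qed

text \<open>The upper bound uses zeta_0, ..., zeta_i. For the lower one, i + 1 independent vectors
  cannot all be supported on the first i coordinates, so one of them has a nonzero coordinate of
  index m >= i, and A B^m >= A B^i because B >= 1.\<close>

lemma succ_min_bounds:
  assumes AB1: "1 \<le> A" "1 \<le> B" and i: "1 \<le> i" "i < n"
  shows "A * B ^ i \<le> real n * 2 ^ (n + 2) * succ_min n (form_ring n f) i"
    and "succ_min n (form_ring n f) i \<le> real n * 2 ^ (n + 2) * (A * B ^ i)"
proof -
  let ?R = "form_ring n f"
  let ?C = "real n * 2 ^ (n + 2)"
  have unit: "form_zeta n f j m = (if m = j then 1 else 0)" if "j < n" for j m
    using that by (simp add: form_zeta_def)
  have indep: "int_independent ?R (i + 1) (form_zeta n f)"
    unfolding int_independent_form_ring_iff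
  proof (intro conjI allI impI)
    fix c :: "nat \<Rightarrow> int" and j
    assume c: "\<forall>m. (\<Sum>j<i + 1. c j * form_zeta n f j m) = 0" and j: "j < i + 1"
    have "(\<Sum>l<i + 1. c l * form_zeta n f l j) = (\<Sum>l<i + 1. if l = j then c l else 0)"
      using i by (intro sum.cong) (auto simp: unit)
    also have "\<dots> = c j" using j by (subst sum.delta) auto
    finally show "c j = 0" using c by metis
  qed (use n in \<open>simp add: form_zeta_eq_0\<close>)
  note attained = succ_min_attained[of ?R n, OF finite_short indep]
  have len: "len (form_zeta n f j) \<le> ?C * (A * B ^ i)" if j: "j \<le> i" for j
  proof (rule len_le)
    show "form_zeta n f j \<in> carrier ?R" using n by (simp add: form_zeta_eq_0)
    show "0 \<le> ?C * (A * B ^ i)" using AB by simp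
    fix \<theta> assume root: "poly (form_poly n f) \<theta> = 0"
    have "(\<Sum>k<n. of_int (form_zeta n f j k) * basis_val f \<theta> k) = (\<Sum>k<n. if k = j then basis_val f \<theta> k else 0)"
      using i j by (intro sum.cong) (auto simp: unit)
    then have val: "(\<Sum>k<n. of_int (form_zeta n f j k) * basis_val f \<theta> k) = basis_val f \<theta> j"
      using i j by simp
    have mono: "A * B ^ j \<le> A * B ^ i"
      using AB1 j by (intro mult_left_mono power_increasing) auto
    show "cmod (\<Sum>k<n. of_int (form_zeta n f j k) * basis_val f \<theta> k) \<le> ?C * (A * B ^ i)"
    proof (cases "j = 0")
      case True
      \<comment> \<open>The element zeta_0 = 1 does not scale with A and B, so it is compared with A
        B^i through A, B >= 1.\<close>
      have "1 * 1 \<le> A * B ^ i" using AB1 by (intro mult_mono one_le_power) auto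
      moreover have "1 * 1 \<le> ?C" using n by (intro mult_mono one_le_power) auto
      ultimately have "1 * 1 \<le> ?C * (A * B ^ i)" by (intro mult_mono) auto
      then show ?thesis unfolding val using True by (simp add: basis_val_def)
    next
      case False
      have "cmod (zeta_val f \<theta> j) \<le> ?C * (A * B ^ j)"
        using zeta_val_bound[OF root, of j] i j by simp
      also have "\<dots> \<le> ?C * (A * B ^ i)" by (rule mult_left_mono[OF mono]) simp
      finally show ?thesis unfolding val using False by (simp add: basis_val_def)
    qed
  qed
  show "succ_min n ?R i \<le> ?C * (A * B ^ i)"
    by (rule attained(2)[OF indep len])
  obtain v where v: "int_independent ?R (i + 1) v" "\<And>j. j < i + 1 \<Longrightarrow> len (v j) \<le> succ_min n ?R i"
    using attained(1) by blast
  have "\<exists>j<i + 1. \<exists>m\<ge>i. v j m \<noteq> 0"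
  proof (rule ccontr)
    assume "\<not> (\<exists>j<i + 1. \<exists>m\<ge>i. v j m \<noteq> 0)"
    then have "\<exists>c. (\<exists>j\<in>{..<i + 1}. c j \<noteq> 0) \<and> (\<forall>k. (\<Sum>j\<in>{..<i + 1}. c j * v j k) = 0)"
      by (intro int_vectors_dependent[of _ i]) auto
    then show False using v(1) unfolding int_independent_form_ring_iff by blast
  qed
  then obtain j m where jm: "j < i + 1" "i \<le> m" "v j m \<noteq> 0" by blast
  have vj: "v j \<in> carrier ?R" using v(1) jm(1) unfolding int_independent_def by auto
  then have m: "m < n" using jm(3) by (simp add: linorder_not_less[symmetric]) blast
  have "A * B ^ i \<le> 1 * (A * B ^ m)"
    using AB1 jm by (simp add: mult_left_mono power_increasing)
  also have "\<dots> \<le> \<bar>real_of_int (v j m)\<bar> * (A * B ^ m)"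
    using jm(3) AB by (intro mult_right_mono) auto
  also have "\<dots> \<le> ?C * len (v j)"
    using coordinate_bound[OF vj, of m] i jm(2) m by simp
  also have "\<dots> \<le> ?C * succ_min n ?R i"
    using v(2)[OF jm(1)] by (intro mult_left_mono) auto
  finally show "A * B ^ i \<le> ?C * succ_min n ?R i" .
qed

end

section \<open>The discriminant near \<open>x\<^sup>n + y\<^sup>n\<close>\<close>

text \<open>The Sylvester matrix of the two partial derivatives, for real coefficients g, so that
  rescaling and limits can be applied to it. The first n - 1 rows come from the x-derivative, the
  others from the y-derivative.\<close>

definition sylvester_entry :: "nat \<Rightarrow> (nat \<Rightarrow> real) \<Rightarrow> nat \<Rightarrow> nat \<Rightarrow> real" where
  "sylvester_entry n g i j =
     (if i < n - 1 then if i \<le> j \<and> j - i \<le> n - 1 then real (n - (j - i)) * g (j - i) else 0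
      else if i - (n - 1) \<le> j \<and> j \<le> i then real (n - (i - j)) * g (n - (i - j)) else 0)"

definition sylvester_det :: "nat \<Rightarrow> (nat \<Rightarrow> real) \<Rightarrow> real" where
  "sylvester_det n g = Determinant.det (mat (n - 1 + (n - 1)) (n - 1 + (n - 1))
     (\<lambda>(i, j). sylvester_entry n g i j))"

lemma coeff_form_dx:
  assumes "k \<le> n - 1" "0 < n"
  shows "coeff (form_dx n f) (n - 1 - k) = int (n - k) * f k"
proof -
  have k: "k < n" using assms by linarith
  have "coeff (form_dx n f) (n - 1 - k) = (\<Sum>i<n. if i = k then int (n - i) * f i else 0)"
    unfolding form_dx_def coeff_sum using assms by (intro sum.cong) auto
  then show ?thesis using k by simp
qed

lemma coeff_form_dy:
  assumes "e < n"
  shows "coeff (form_dy n f) e = int (n - e) * f (n - e)"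
proof -
  have "coeff (form_dy n f) e = (\<Sum>i=1..n. if i = n - e then int i * f i else 0)"
    unfolding form_dy_def coeff_sum using assms by (intro sum.cong) auto
  then show ?thesis using assms by simp
qed

lemma det_sylvester_form:
  assumes "2 \<le> n"
  shows "real_of_int (Determinant.det (sylvester_mat_sub (n - 1) (n - 1) (form_dx n f) (form_dy n f)))
       = sylvester_det n (\<lambda>i. real_of_int (f i))"
proof -
  let ?S = "sylvester_mat_sub (n - 1) (n - 1) (form_dx n f) (form_dy n f)"
  have "map_mat real_of_int ?S = mat (n - 1 + (n - 1)) (n - 1 + (n - 1))
      (\<lambda>(i, j). sylvester_entry n (\<lambda>i. real_of_int (f i)) i j)"
  proof (rule eq_matI)
    fix i j
    assume "i < dim_row (mat (n - 1 + (n - 1)) (n - 1 + (n - 1)) (\<lambda>(i, j). sylvester_entry n (\<lambda>i. real_of_int (f i)) i j))"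
      and "j < dim_col (mat (n - 1 + (n - 1)) (n - 1 + (n - 1)) (\<lambda>(i, j). sylvester_entry n (\<lambda>i. real_of_int (f i)) i j))"
    then have ij: "i < n - 1 + (n - 1)" "j < n - 1 + (n - 1)" by auto
    have top: "coeff (form_dx n f) (n - 1 + i - j) = int (n - (j - i)) * f (j - i)"
      if "i \<le> j" "j - i \<le> n - 1"
    proof -
      have "n - 1 + i - j = n - 1 - (j - i)" using that by simp
      then show ?thesis using coeff_form_dx[of "j - i" n f] that assms by simp
    qed
    have bottom: "coeff (form_dy n f) (i - j) = int (n - (i - j)) * f (n - (i - j))"
      if "i - (n - 1) \<le> j"
      using that assms ij by (intro coeff_form_dy) linarith
    have "real_of_int (?S $$ (i, j)) = sylvester_entry n (\<lambda>i. real_of_int (f i)) i j"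
    proof -
      consider (upper) "i < n - 1" "i \<le> j" "j - i \<le> n - 1"
        | (upper_0) "i < n - 1" "\<not> (i \<le> j \<and> j - i \<le> n - 1)"
        | (lower) "\<not> i < n - 1" "i - (n - 1) \<le> j" "j \<le> i"
        | (lower_0) "\<not> i < n - 1" "\<not> (i - (n - 1) \<le> j \<and> j \<le> i)"
        by blast
      then show ?thesis
        unfolding sylvester_mat_sub_index[OF ij] sylvester_entry_def
        by cases (simp_all only: top bottom if_True if_False simp_thms of_int_mult of_int_of_nat_eq of_int_0)
    qed
    then show "map_mat real_of_int ?S $$ (i, j) = mat (n - 1 + (n - 1)) (n - 1 + (n - 1))
      (\<lambda>(i, j). sylvester_entry n (\<lambda>i. real_of_int (f i)) i j) $$ (i, j)"
      using ij by simp
  qed auto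
  then show ?thesis by (simp add: sylvester_det_def flip: of_int_hom.hom_det)
qed

lemma sylvester_det_sum:
  "sylvester_det n g = (\<Sum>p | p permutes {0..<n - 1 + (n - 1)}.
     signof p * (\<Prod>i=0..<n - 1 + (n - 1). sylvester_entry n g i (p i)))"
  unfolding sylvester_det_def
  by (subst det_def'[of _ "n - 1 + (n - 1)"])
    (auto intro!: sum.cong prod.cong simp: permutes_in_image)

text \<open>
  Multiplying row \<open>i\<close> by \<open>B\<^sup>i\<close> (respectively \<open>B\<^sup>i\<^sup>-\<^sup>n\<^sup>+\<^sup>1\<close> in the lower half) makes the power of \<open>B\<close> in each
  entry depend on its column only, up to one extra factor in the lower half.
\<close>

lemma sylvester_entry_scale:
  assumes "i < n - 1 + (n - 1)" "2 \<le> n"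
  shows "sylvester_entry n (\<lambda>i. A * B ^ i * g i) i j * B ^ (if i < n - 1 then i else i - (n - 1))
       = A * B ^ (if i < n - 1 then 0 else 1) * B ^ j * sylvester_entry n g i j"
proof -
  have e1: "B ^ (j - i) * B ^ i = B ^ j" if "i \<le> j"
    using that by (simp flip: power_add)
  have e2: "B ^ (n - (i - j)) * B ^ (i - (n - 1)) = B * B ^ j" if "i - (n - 1) \<le> j" "j \<le> i" "\<not> i < n - 1"
  proof -
    have "n - (i - j) + (i - (n - 1)) = Suc j" using that assms by linarith
    then show ?thesis by (simp flip: power_add)
  qed
  show ?thesis
    unfolding sylvester_entry_def using e1 e2 by (auto simp: mult_ac)
qed

text \<open>With N = n - 1, these are the powers of B contributed by the extra factors of the lower
  half, by the row multipliers and by the columns.\<close>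

lemma prod_pow_if_lower:
  fixes B :: real
  shows "(\<Prod>i=0..<N + N. B ^ (if i < N then 0 else 1)) = B ^ N"
    and "(\<Prod>i=0..<N + N. B ^ (if i < N then i else i - N)) = B ^ (N * (N - 1))"
    and "(\<Prod>i=0..<N + N. B ^ i) = B ^ (N * (2 * N - 1))"
proof -
  have gauss: "2 * (\<Sum>i=0..<m. i) = m * (m - 1)" for m :: nat
    by (induction m) (auto simp: algebra_simps)
  have "(\<Sum>i=0..<N + N. if i < N then 0 else 1 :: nat) = (\<Sum>i=N..<N + N. 1)"
    by (intro sum.mono_neutral_cong_right) auto
  then show "(\<Prod>i=0..<N + N. B ^ (if i < N then 0 else 1)) = B ^ N"
    by (simp add: power_sum[symmetric])
  have "(\<Sum>i=0..<N + N. if i < N then i else i - N)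
      = (\<Sum>i=0..<N. if i < N then i else i - N) + (\<Sum>i=N..<N + N. if i < N then i else i - N)"
    by (rule sum.atLeastLessThan_concat[symmetric]) auto
  also have "(\<Sum>i=0..<N. if i < N then i else i - N) = (\<Sum>i=0..<N. i)"
    by (intro sum.cong) auto
  also have "(\<Sum>i=N..<N + N. if i < N then i else i - N) = (\<Sum>i=0..<N. i)"
    using sum.shift_bounds_nat_ivl[of "\<lambda>i. if i < N then i else i - N" 0 N N] by simp
  finally have "(\<Sum>i=0..<N + N. if i < N then i else i - N) = N * (N - 1)"
    using gauss[of N] by simp
  then show "(\<Prod>i=0..<N + N. B ^ (if i < N then i else i - N)) = B ^ (N * (N - 1))"
    by (simp only: power_sum[symmetric])
  have "(\<Sum>i=0..<N + N. i) = N * (2 * N - 1)"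
    using gauss[of "N + N"] by (simp add: mult_2[symmetric] mult.assoc)
  then show "(\<Prod>i=0..<N + N. B ^ i) = B ^ (N * (2 * N - 1))"
    by (simp only: power_sum[symmetric])
qed

text \<open>In the permutation expansion every column is met once, so the power of B is the same in
  each term and factors out.\<close>

lemma sylvester_det_scale:
  assumes n: "2 \<le> n" and B: "B > 0"
  shows "sylvester_det n (\<lambda>i. A * B ^ i * g i) = A ^ (2 * n - 2) * B ^ (n * (n - 1)) * sylvester_det n g"
proof -
  define N where "N = n - 1"
  have nN: "n = Suc N" using n by (simp add: N_def)
  then have double: "2 * n - 2 = N + N" by simp
  let ?r = "\<Prod>i=0..<N + N. B ^ (if i < N then i else i - N)"
  have "sylvester_det n (\<lambda>i. A * B ^ i * g i) * ?r = A ^ (N + N) * (B ^ N * B ^ (N * (2 * N - 1))) * sylvester_det n g"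
    unfolding sylvester_det_sum sum_distrib_right sum_distrib_left N_def[symmetric]
  proof (rule sum.cong)
    fix p assume "p \<in> {p. p permutes {0..<N + N}}"
    then have p: "p permutes {0..<N + N}" by simp
    have "(\<Prod>i=0..<N + N. sylvester_entry n (\<lambda>i. A * B ^ i * g i) i (p i)) * ?r
        = (\<Prod>i=0..<N + N. A * B ^ (if i < N then 0 else 1) * B ^ p i * sylvester_entry n g i (p i))"
      unfolding prod.distrib[symmetric]
    proof (rule prod.cong[OF refl])
      fix i assume "i \<in> {0..<N + N}"
      then have "i < n - 1 + (n - 1)" by (simp add: N_def)
      from sylvester_entry_scale[OF this n, of A B g "p i"]
      show "sylvester_entry n (\<lambda>i. A * B ^ i * g i) i (p i) * B ^ (if i < N then i else i - N)
          = A * B ^ (if i < N then 0 else 1) * B ^ p i * sylvester_entry n g i (p i)"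
        unfolding N_def .
    qed
    also have "\<dots> = A ^ (N + N) * B ^ N * (\<Prod>i=0..<N + N. B ^ p i) * (\<Prod>i=0..<N + N. sylvester_entry n g i (p i))"
      by (simp only: prod.distrib prod_pow_if_lower(1)) simp
    also have "(\<Prod>i=0..<N + N. B ^ p i) = B ^ (N * (2 * N - 1))"
      using prod.permute[OF p, of "\<lambda>i. B ^ i"] by (simp add: prod_pow_if_lower o_def)
    finally show "signof p * (\<Prod>i=0..<N + N. sylvester_entry n (\<lambda>i. A * B ^ i * g i) i (p i)) * ?r
       = A ^ (N + N) * (B ^ N * B ^ (N * (2 * N - 1))) * (signof p * (\<Prod>i=0..<N + N. sylvester_entry n g i (p i)))"
      by (simp add: mult_ac)
  qed simp
  also have "?r = B ^ (N * (N - 1))" by (rule prod_pow_if_lower(2))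
  \<comment> \<open>The total N + N (2 N - 1) exceeds the exponent N (N - 1) of the row multipliers
    by N (N + 1) = n (n - 1).\<close>
  also have "B ^ N * B ^ (N * (2 * N - 1)) = B ^ (n * (n - 1)) * B ^ (N * (N - 1))"
  proof -
    have "N + N * (2 * N - 1) = n * (n - 1) + N * (N - 1)"
      using nN by (cases N) (auto simp: algebra_simps)
    then show ?thesis by (simp only: power_add[symmetric])
  qed
  finally have "sylvester_det n (\<lambda>i. A * B ^ i * g i) * B ^ (N * (N - 1))
      = A ^ (2 * n - 2) * B ^ (n * (n - 1)) * sylvester_det n g * B ^ (N * (N - 1))"
    unfolding double by (simp only: mult_ac)
  then show ?thesis using B by simp
qed

text \<open>The derivatives n x^(n-1) and n y^(n-1) give n times the identity matrix.\<close>

lemma sylvester_det_fermat: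
  assumes "2 \<le> n"
  shows "sylvester_det n (fermat_coeff n) = real n ^ (2 * n - 2)"
proof -
  have "mat (n - 1 + (n - 1)) (n - 1 + (n - 1)) (\<lambda>(i, j). sylvester_entry n (fermat_coeff n) i j)
      = real n \<cdot>\<^sub>m 1\<^sub>m (n - 1 + (n - 1))"
    using assms by (intro eq_matI) (auto simp: sylvester_entry_def fermat_coeff_def)
  then show ?thesis using assms by (simp add: sylvester_det_def mult_2)
qed

text \<open>Continuity of the determinant in the coefficients, by sequences: failure for every
  \<delta> = 1 / (k + 1) would give coefficients converging to the model while the determinants stay
  away.\<close>

lemma sylvester_det_near_fermat:
  assumes n: "2 \<le> n" and \<epsilon>: "\<epsilon> > 0"
  shows "\<exists>\<delta>>0. \<forall>g. (\<forall>i\<le>n. \<bar>g i - fermat_coeff n i\<bar> \<le> \<delta>) \<longrightarrow>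
    \<bar>sylvester_det n g - real n ^ (2 * n - 2)\<bar> < \<epsilon>"
proof (rule ccontr)
  assume neg: "\<not> ?thesis"
  have "\<exists>g. (\<forall>i\<le>n. \<bar>g i - fermat_coeff n i\<bar> \<le> inverse (real (Suc k))) \<and>
      \<not> \<bar>sylvester_det n g - real n ^ (2 * n - 2)\<bar> < \<epsilon>" for k
    using neg by (metis inverse_positive_iff_positive of_nat_0_less_iff zero_less_Suc)
  then obtain g where g: "\<And>k i. i \<le> n \<Longrightarrow> \<bar>g k i - fermat_coeff n i\<bar> \<le> inverse (real (Suc k))"
    and bad: "\<And>k. \<not> \<bar>sylvester_det n (g k) - real n ^ (2 * n - 2)\<bar> < \<epsilon>"
    by metis
  have lim: "(\<lambda>k. g k i) \<longlonglongrightarrow> fermat_coeff n i" if "i \<le> n" for i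
  proof -
    have "(\<lambda>k. g k i - fermat_coeff n i) \<longlonglongrightarrow> 0"
      by (rule Lim_null_comparison[OF _ LIMSEQ_inverse_real_of_nat]) (use g[OF that] in simp)
    then show ?thesis by (simp add: LIM_zero_iff)
  qed
  have "(\<lambda>k. sylvester_entry n (g k) i j) \<longlonglongrightarrow> sylvester_entry n (fermat_coeff n) i j" for i j
    unfolding sylvester_entry_def using n
    by (cases "i < n - 1"; cases "i \<le> j \<and> j - i \<le> n - 1"; cases "i - (n - 1) \<le> j \<and> j \<le> i")
      (auto intro!: tendsto_intros lim)
  then have "(\<lambda>k. sylvester_det n (g k)) \<longlonglongrightarrow> sylvester_det n (fermat_coeff n)"
    unfolding sylvester_det_sum by (intro tendsto_intros)
  then have "(\<lambda>k. sylvester_det n (g k)) \<longlonglongrightarrow> real n ^ (2 * n - 2)"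
    unfolding sylvester_det_fermat[OF n] .
  then have "\<forall>\<^sub>F k in sequentially. dist (sylvester_det n (g k)) (real n ^ (2 * n - 2)) < \<epsilon>"
    using \<epsilon> by (rule tendstoD)
  then obtain k where "dist (sylvester_det n (g k)) (real n ^ (2 * n - 2)) < \<epsilon>"
    by (meson eventually_happens' sequentially_bot)
  then show False using bad[of k] by (simp add: dist_real_def)
qed

text \<open>Dividing f_i by A B^i reduces to coefficients near the model, where the determinant lies
  within half of n^(2n-2). Removing n^(n-2) leaves n^n; the factors 1/2 and 2 confine the
  discriminant to a range of ratio 4.\<close>

lemma near_forms_disc_bounds:
  assumes n: "2 \<le> n"
  shows "\<exists>\<delta>>0. \<forall>A B f. A > 0 \<longrightarrow> B > 0 \<longrightarrow> f \<in> near_forms n \<delta> A B \<longrightarrow>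
    real n ^ n / 2 * (A ^ (2 * n - 2) * B ^ (n * (n - 1))) \<le> \<bar>form_disc n f\<bar> \<and>
    \<bar>form_disc n f\<bar> \<le> 2 * real n ^ n * (A ^ (2 * n - 2) * B ^ (n * (n - 1)))"
proof -
  have "real n ^ (2 * n - 2) / 2 > 0" using n by simp
  then obtain \<delta> where \<delta>: "\<delta> > 0" and close: "\<And>g. (\<forall>i\<le>n. \<bar>g i - fermat_coeff n i\<bar> \<le> \<delta>) \<Longrightarrow>
    \<bar>sylvester_det n g - real n ^ (2 * n - 2)\<bar> < real n ^ (2 * n - 2) / 2"
    using sylvester_det_near_fermat[OF n] by metis
  have "real n ^ n / 2 * (A ^ (2 * n - 2) * B ^ (n * (n - 1))) \<le> \<bar>form_disc n f\<bar> \<and>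
    \<bar>form_disc n f\<bar> \<le> 2 * real n ^ n * (A ^ (2 * n - 2) * B ^ (n * (n - 1)))"
    if AB: "A > 0" "B > 0" and f: "f \<in> near_forms n \<delta> A B" for A B f
  proof -
    define g where "g i = real_of_int (f i) / (A * B ^ i)" for i
    have fg: "real_of_int (f i) = A * B ^ i * g i" for i
      using AB by (simp add: g_def)
    have "\<bar>g i - fermat_coeff n i\<bar> \<le> \<delta>" if "i \<le> n" for i
    proof -
      have "A * B ^ i * \<bar>g i - fermat_coeff n i\<bar> = \<bar>A * B ^ i * (g i - fermat_coeff n i)\<bar>"
        using AB by (simp add: abs_mult)
      also have "\<dots> \<le> A * B ^ i * \<delta>"
        using f that by (simp add: near_forms_def fg algebra_simps)
      finally show ?thesis using AB by simp
    qed
    then have det: "\<bar>sylvester_det n g - real n ^ (2 * n - 2)\<bar> < real n ^ (2 * n - 2) / 2"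
      by (intro close) auto
    let ?Y = "A ^ (2 * n - 2) * B ^ (n * (n - 1))"
    have Y: "?Y > 0" using AB by simp
    have "\<bar>form_disc n f\<bar> = \<bar>sylvester_det n (\<lambda>i. A * B ^ i * g i)\<bar> / real n ^ (n - 2)"
      unfolding form_disc_def det_sylvester_form[OF n] fg by (simp add: abs_mult)
    also have "\<dots> = ?Y * (\<bar>sylvester_det n g\<bar> / real n ^ (n - 2))"
      unfolding sylvester_det_scale[OF n AB(2)] using AB by (simp add: abs_mult)
    finally have disc: "\<bar>form_disc n f\<bar> = ?Y * (\<bar>sylvester_det n g\<bar> / real n ^ (n - 2))" .
    have pow: "real n ^ (2 * n - 2) = real n ^ n * real n ^ (n - 2)"
      using n by (simp flip: power_add add: mult_2)
    have pos: "real n ^ (n - 2) > 0" using n by simp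
    have "real n ^ n / 2 * real n ^ (n - 2) \<le> \<bar>sylvester_det n g\<bar>"
      "\<bar>sylvester_det n g\<bar> \<le> 2 * real n ^ n * real n ^ (n - 2)"
      using det unfolding pow by linarith+
    then have quot: "real n ^ n / 2 \<le> \<bar>sylvester_det n g\<bar> / real n ^ (n - 2)"
      "\<bar>sylvester_det n g\<bar> / real n ^ (n - 2) \<le> 2 * real n ^ n"
      using pos by (simp_all only: pos_le_divide_eq pos_divide_le_eq)
    have "?Y * (real n ^ n / 2) \<le> \<bar>form_disc n f\<bar>"
      unfolding disc using Y by (intro mult_left_mono[OF quot(1)]) linarith
    moreover have "\<bar>form_disc n f\<bar> \<le> ?Y * (2 * real n ^ n)"
      unfolding disc using Y by (intro mult_left_mono[OF quot(2)]) linarith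
    ultimately show ?thesis by (metis mult.commute)
  qed
  then show ?thesis using \<delta> by blast
qed

section \<open>Orbits\<close>

text \<open>At i = n the truncated exponent \<open>n - i - 1\<close> is harmless because
  \<open>int (n - i)\<close> vanishes; the same holds for i = 0 in
  \<open>form_grad_y\<close>.\<close>

definition form_grad_x :: "nat \<Rightarrow> (nat \<Rightarrow> int) \<Rightarrow> int \<Rightarrow> int \<Rightarrow> int" where
  "form_grad_x n f x y = (\<Sum>i\<le>n. int (n - i) * f i * x ^ (n - i - 1) * y ^ i)"

definition form_grad_y :: "nat \<Rightarrow> (nat \<Rightarrow> int) \<Rightarrow> int \<Rightarrow> int \<Rightarrow> int" where
  "form_grad_y n f x y = (\<Sum>i\<le>n. int i * f i * x ^ (n - i) * y ^ (i - 1))"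

lemma form_euler: "x * form_grad_x n f x y + y * form_grad_y n f x y = int n * form_eval n f x y"
  unfolding form_grad_x_def form_grad_y_def form_eval_def sum_distrib_left sum.distrib[symmetric]
proof (rule sum.cong[OF refl])
  fix i assume "i \<in> {..n}"
  then have i: "i \<le> n" by simp
  have x: "x * (int (n - i) * f i * x ^ (n - i - 1) * y ^ i) = int (n - i) * (f i * x ^ (n - i) * y ^ i)"
    by (cases "n - i") auto
  have y: "y * (int i * f i * x ^ (n - i) * y ^ (i - 1)) = int i * (f i * x ^ (n - i) * y ^ i)"
    by (cases i) auto
  have "int (n - i) * z + int i * z = int n * z" for z
    using i by (simp add: of_nat_diff algebra_simps)
  then show "x * (int (n - i) * f i * x ^ (n - i - 1) * y ^ i) + y * (int i * f i * x ^ (n - i) * y ^ (i - 1))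
      = int n * (f i * x ^ (n - i) * y ^ i)"
    unfolding x y .
qed

lemma int_poly_eqI:
  fixes p q :: "int poly"
  assumes "\<And>x. poly p x = poly q x"
  shows "p = q"
proof (rule ccontr)
  assume "p \<noteq> q"
  then have "finite {x. poly (p - q) x = 0}" by (intro poly_roots_finite) simp
  moreover have "{x. poly (p - q) x = 0} = UNIV" using assms by simp
  ultimately show False by (simp add: infinite_UNIV_int)
qed

lemma binary_forms_eqI:
  assumes "h \<in> binary_forms n" "h' \<in> binary_forms n" "\<And>x y. form_eval n h x y = form_eval n h' x y"
  shows "h = h'"
proof
  fix i
  have "(\<Sum>i\<le>n. monom (h i) i) = (\<Sum>i\<le>n. monom (h' i) i)"
    using assms(3)[of 1] by (intro int_poly_eqI) (simp add: poly_sum poly_monom form_eval_def)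
  then have "coeff (\<Sum>i\<le>n. monom (h i) i) i = coeff (\<Sum>i\<le>n. monom (h' i) i) i" by simp
  then show "h i = h' i"
    using assms(1,2) by (cases "i \<le> n") (auto simp: coeff_sum binary_forms_def)
qed

lemma form_eval_rev: "form_eval n (\<lambda>i. f (n - i)) x y = form_eval n f y x"
  unfolding form_eval_def
  by (rule sum.reindex_bij_witness[of _ "\<lambda>i. n - i" "\<lambda>i. n - i"]) auto

text \<open>Setting x = 1 leaves a polynomial in y. Its value at y = 0 is f at the first column (a,
  c), and its derivative there is the derivative of f at (a, c) in the direction of the second
  column.\<close>

lemma substituted_coeffs_first:
  assumes n: "1 \<le> n"
    and h: "\<And>x y. form_eval n h x y = form_eval n f (a * x + b * y) (c * x + d * y)"
  shows "h 0 = form_eval n f a c"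
    and "h 1 = b * form_grad_x n f a c + d * form_grad_y n f a c"
proof -
  have "form_eval n h 1 0 = (\<Sum>i\<le>n. if i = 0 then h i else 0)"
    unfolding form_eval_def by (intro sum.cong) auto
  then show "h 0 = form_eval n f a c" using h[of 1 0] by simp
  have eq: "(\<Sum>i\<le>n. monom (h i) i) = (\<Sum>i\<le>n. [:f i:] * [:a, b:] ^ (n - i) * [:c, d:] ^ i)"
    using h[of 1] by (intro int_poly_eqI) (simp add: poly_sum poly_monom form_eval_def mult_ac)
  have "h 1 = coeff (\<Sum>i\<le>n. monom (h i) i) 1"
    using n by (simp add: coeff_sum)
  also have "\<dots> = poly (pderiv (\<Sum>i\<le>n. monom (h i) i)) 0"
    by (simp add: poly_0_coeff_0 coeff_pderiv)
  also have "\<dots> = (\<Sum>i\<le>n. poly (pderiv ([:f i:] * [:a, b:] ^ (n - i) * [:c, d:] ^ i)) 0)"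
    by (simp only: eq pderiv_sum poly_sum)
  also have "\<dots> = (\<Sum>i\<le>n. b * (int (n - i) * f i * a ^ (n - i - 1) * c ^ i)
      + d * (int i * f i * a ^ (n - i) * c ^ (i - 1)))"
  proof (rule sum.cong[OF refl])
    fix i
    show "poly (pderiv ([:f i:] * [:a, b:] ^ (n - i) * [:c, d:] ^ i)) 0
        = b * (int (n - i) * f i * a ^ (n - i - 1) * c ^ i) + d * (int i * f i * a ^ (n - i) * c ^ (i - 1))"
      by (simp only: pderiv_mult pderiv_power poly_add poly_mult poly_power poly_smult)
        (simp add: pderiv_pCons algebra_simps del: of_nat_diff)
  qed
  finally show "h 1 = b * form_grad_x n f a c + d * form_grad_y n f a c"
    by (simp add: form_grad_x_def form_grad_y_def sum.distrib sum_distrib_left)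
qed

text \<open>Reversing the coefficients of h interchanges x and y, that is, the two columns of the
  substitution.\<close>

lemma substituted_coeffs_last:
  assumes n: "1 \<le> n"
    and h: "\<And>x y. form_eval n h x y = form_eval n f (a * x + b * y) (c * x + d * y)"
  shows "h n = form_eval n f b d"
    and "h (n - 1) = a * form_grad_x n f b d + c * form_grad_y n f b d"
proof -
  have "form_eval n (\<lambda>i. h (n - i)) x y = form_eval n f (b * x + a * y) (d * x + c * y)" for x y
    unfolding form_eval_rev h by (simp add: add.commute)
  from substituted_coeffs_first[OF n this]
  show "h n = form_eval n f b d" "h (n - 1) = a * form_grad_x n f b d + c * form_grad_y n f b d"
    by auto
qed

text \<open>The model has gradient n A (x^(n-1), B^n y^(n-1)). If |x| dominates B |y|, its first
  component is large, otherwise its second; the coefficient errors disturb the chosen component by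
  at most 1/8 of its size.\<close>

lemma (in near_form) gradient_lower_bound:
  assumes U: "\<bar>real_of_int (form_grad_x n f x y)\<bar> \<le> A * U" "\<bar>real_of_int (form_grad_y n f x y)\<bar> \<le> A * B * U"
  shows "max \<bar>real_of_int x\<bar> (B * \<bar>real_of_int y\<bar>) ^ (n - 1) * (real n / 2) \<le> U"
proof -
  define E where "E i = real_of_int (f i) - A * B ^ i * fermat_coeff n i" for i
  define m where "m = max \<bar>real_of_int x\<bar> (B * \<bar>real_of_int y\<bar>)"
  have m: "\<bar>real_of_int x\<bar> \<le> m" "B * \<bar>real_of_int y\<bar> \<le> m" "m \<ge> 0"
    by (auto simp: m_def)
  have mon: "\<bar>real_of_int x\<bar> ^ i * (B * \<bar>real_of_int y\<bar>) ^ j \<le> m ^ (n - 1)" if "i + j = n - 1" for i j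
  proof -
    have "\<bar>real_of_int x\<bar> ^ i * (B * \<bar>real_of_int y\<bar>) ^ j \<le> m ^ i * m ^ j"
      using m AB by (intro mult_mono power_mono) auto
    then show ?thesis using that by (simp flip: power_add)
  qed
  have pow: "m ^ (n - 1) \<ge> 0" using m by simp
  have total: "(\<Sum>i\<le>n. real n * (\<delta> * W) * m ^ (n - 1)) \<le> real n / 8 * W * m ^ (n - 1)" if "W \<ge> 0" for W
  proof -
    have "(\<Sum>i\<le>n. real n * (\<delta> * W) * m ^ (n - 1)) = (real n + 1) * \<delta> * (real n * W * m ^ (n - 1))"
      by (simp add: algebra_simps)
    also have "\<dots> \<le> 1 / 8 * (real n * W * m ^ (n - 1))"
      using that pow by (intro mult_right_mono[OF delta_linear_small]) auto
    finally show ?thesis by simp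
  qed
  have real_E: "real_of_int (f i) = A * B ^ i * fermat_coeff n i + E i" for i by (simp add: E_def)
  \<comment> \<open>Common end of both cases, with scale W = A for the x-component and W = A B for
    the y-component.\<close>
  have conclude: "m ^ (n - 1) * (real n / 2) \<le> U"
    if W: "W > 0" and g: "\<bar>g\<bar> \<le> W * U" and main: "\<bar>main\<bar> = real n * W * m ^ (n - 1)"
      and rest: "\<bar>g - main\<bar> \<le> real n / 8 * W * m ^ (n - 1)" for W g main
  proof -
    have "real n * W * m ^ (n - 1) - real n / 8 * W * m ^ (n - 1) \<le> W * U"
      using g rest main[symmetric] by linarith
    moreover have "W * (m ^ (n - 1) * (real n / 2)) \<le> real n * W * m ^ (n - 1) - real n / 8 * W * m ^ (n - 1)"
      using W pow by (simp add: algebra_simps)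
    ultimately have "W * (m ^ (n - 1) * (real n / 2)) \<le> W * U" by linarith
    then show ?thesis using W by simp
  qed
  have "m ^ (n - 1) * (real n / 2) \<le> U"
  proof (cases "B * \<bar>real_of_int y\<bar> \<le> \<bar>real_of_int x\<bar>")
    case True
    then have mx: "m = \<bar>real_of_int x\<bar>" by (simp add: m_def)
    let ?main = "real n * A * real_of_int x ^ (n - 1)"
    have "real_of_int (form_grad_x n f x y)
        = (\<Sum>i\<le>n. real (n - i) * (A * B ^ i * fermat_coeff n i) * real_of_int x ^ (n - i - 1) * real_of_int y ^ i)
        + (\<Sum>i\<le>n. real (n - i) * E i * real_of_int x ^ (n - i - 1) * real_of_int y ^ i)"
      by (simp add: form_grad_x_def real_E distrib_left distrib_right sum.distrib)
    also have "(\<Sum>i\<le>n. real (n - i) * (A * B ^ i * fermat_coeff n i) * real_of_int x ^ (n - i - 1) * real_of_int y ^ i)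
        = (\<Sum>i\<in>{0::nat}. real n * A * real_of_int x ^ (n - 1))"
      by (intro sum.mono_neutral_cong_right) (auto simp: fermat_coeff_def)
    finally have "\<bar>real_of_int (form_grad_x n f x y) - ?main\<bar>
        = \<bar>\<Sum>i\<le>n. real (n - i) * E i * real_of_int x ^ (n - i - 1) * real_of_int y ^ i\<bar>" by simp
    also have "\<dots> \<le> (\<Sum>i\<le>n. real n * (\<delta> * A) * m ^ (n - 1))"
    proof (rule order.trans[OF sum_abs sum_mono])
      fix i assume "i \<in> {..n}"
      then consider "i = n" | "i < n" by fastforce
      then show "\<bar>real (n - i) * E i * real_of_int x ^ (n - i - 1) * real_of_int y ^ i\<bar> \<le> real n * (\<delta> * A) * m ^ (n - 1)"
      proof cases
        case 1
        then show ?thesis using \<delta> AB pow by simp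
      next
        case 2
        have "\<bar>real (n - i) * E i * real_of_int x ^ (n - i - 1) * real_of_int y ^ i\<bar>
            = real (n - i) * \<bar>E i\<bar> * (\<bar>real_of_int x\<bar> ^ (n - i - 1) * \<bar>real_of_int y\<bar> ^ i)"
          by (simp add: abs_mult power_abs)
        also have "\<dots> \<le> real n * (\<delta> * (A * B ^ i)) * (\<bar>real_of_int x\<bar> ^ (n - i - 1) * \<bar>real_of_int y\<bar> ^ i)"
          using error[of i] 2 \<delta> AB by (intro mult_right_mono mult_mono) (auto simp: E_def)
        also have "\<dots> = real n * (\<delta> * A) * (\<bar>real_of_int x\<bar> ^ (n - i - 1) * (B * \<bar>real_of_int y\<bar>) ^ i)"
          by (simp add: power_mult_distrib)
        also have "\<dots> \<le> real n * (\<delta> * A) * m ^ (n - 1)"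
          using \<delta> AB 2 by (intro mult_left_mono mon) auto
        finally show ?thesis .
      qed
    qed
    also have "\<dots> \<le> real n / 8 * A * m ^ (n - 1)" using AB by (intro total) simp
    finally show ?thesis
      using AB U(1) by (intro conclude[of A "real_of_int (form_grad_x n f x y)" ?main])
        (auto simp: abs_mult power_abs mx)
  next
    case False
    then have my: "m = B * \<bar>real_of_int y\<bar>" by (simp add: m_def)
    let ?main = "real n * (A * B ^ n) * real_of_int y ^ (n - 1)"
    have Bn: "B ^ n = B * B ^ (n - 1)" using n by (simp flip: power_Suc)
    have "real_of_int (form_grad_y n f x y)
        = (\<Sum>i\<le>n. real i * (A * B ^ i * fermat_coeff n i) * real_of_int x ^ (n - i) * real_of_int y ^ (i - 1))
        + (\<Sum>i\<le>n. real i * E i * real_of_int x ^ (n - i) * real_of_int y ^ (i - 1))"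
      by (simp add: form_grad_y_def real_E distrib_left distrib_right sum.distrib)
    also have "(\<Sum>i\<le>n. real i * (A * B ^ i * fermat_coeff n i) * real_of_int x ^ (n - i) * real_of_int y ^ (i - 1))
        = (\<Sum>i\<in>{n}. ?main)"
      by (intro sum.mono_neutral_cong_right) (auto simp: fermat_coeff_def)
    finally have "\<bar>real_of_int (form_grad_y n f x y) - ?main\<bar>
        = \<bar>\<Sum>i\<le>n. real i * E i * real_of_int x ^ (n - i) * real_of_int y ^ (i - 1)\<bar>" by simp
    also have "\<dots> \<le> (\<Sum>i\<le>n. real n * (\<delta> * (A * B)) * m ^ (n - 1))"
    proof (rule order.trans[OF sum_abs sum_mono])
      fix i assume "i \<in> {..n}"
      then consider "i = 0" | "0 < i" "i \<le> n" by fastforce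
      then show "\<bar>real i * E i * real_of_int x ^ (n - i) * real_of_int y ^ (i - 1)\<bar> \<le> real n * (\<delta> * (A * B)) * m ^ (n - 1)"
      proof cases
        case 1
        then show ?thesis using \<delta> AB pow by simp
      next
        case 2
        have Bi: "B ^ i = B * B ^ (i - 1)" using 2 by (simp flip: power_Suc)
        have "\<bar>real i * E i * real_of_int x ^ (n - i) * real_of_int y ^ (i - 1)\<bar>
            = real i * \<bar>E i\<bar> * (\<bar>real_of_int x\<bar> ^ (n - i) * \<bar>real_of_int y\<bar> ^ (i - 1))"
          by (simp add: abs_mult power_abs)
        also have "\<dots> \<le> real n * (\<delta> * (A * B ^ i)) * (\<bar>real_of_int x\<bar> ^ (n - i) * \<bar>real_of_int y\<bar> ^ (i - 1))"
          using error[of i] 2 \<delta> AB by (intro mult_right_mono mult_mono) (auto simp: E_def)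
        also have "\<dots> = real n * (\<delta> * (A * B)) * (\<bar>real_of_int x\<bar> ^ (n - i) * (B * \<bar>real_of_int y\<bar>) ^ (i - 1))"
          unfolding Bi by (simp add: power_mult_distrib)
        also have "\<dots> \<le> real n * (\<delta> * (A * B)) * m ^ (n - 1)"
          using \<delta> AB 2 by (intro mult_left_mono mon) auto
        finally show ?thesis .
      qed
    qed
    also have "\<dots> \<le> real n / 8 * (A * B) * m ^ (n - 1)" using AB by (intro total) simp
    finally show ?thesis
      using AB U(2) by (intro conclude[of "A * B" "real_of_int (form_grad_y n f x y)" ?main])
        (auto simp: abs_mult power_abs my Bn power_mult_distrib)
  qed
  then show ?thesis by (simp add: m_def)
qed

text \<open>The gradient argument bounds the rescaled matrix. For large B this still allows many
  translations b, and these are excluded by the smallness of the coefficients with index 1.\<close>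

lemma substitution_entries_bounded:
  assumes n: "3 \<le> n" and f: "near_form n \<delta> A B f" and h: "near_form n \<delta> A B h" and B1: "1 \<le> B"
    and f1: "\<bar>real_of_int (f 1)\<bar> \<le> A / 8" and h1: "\<bar>real_of_int (h 1)\<bar> \<le> A / 8"
    and det: "\<bar>a * d - b * c\<bar> = 1"
    and subst: "\<And>x y. form_eval n h x y = form_eval n f (a * x + b * y) (c * x + d * y)"
  shows "a \<in> {-64..64}" "b \<in> {-64..64}" "c \<in> {-64..64}" "d \<in> {-64..64}"
proof -
  interpret f: near_form n \<delta> A B f by (rule f)
  interpret h: near_form n \<delta> A B h by (rule h)
  note AB = f.AB
  have n1: "1 \<le> n" using n by simp
  \<comment> \<open>In the coordinates (x, B y) the matrix has entries a, b / B, B c, d; s is its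
    largest entry in absolute value.\<close>
  define s where "s = Max {\<bar>real_of_int a\<bar>, B * \<bar>real_of_int c\<bar>, \<bar>real_of_int b\<bar> / B, \<bar>real_of_int d\<bar>}"
  have s: "\<bar>real_of_int a\<bar> \<le> s" "B * \<bar>real_of_int c\<bar> \<le> s" "\<bar>real_of_int b\<bar> / B \<le> s" "\<bar>real_of_int d\<bar> \<le> s"
    unfolding s_def by (intro Max_ge; simp)+
  have sb: "\<bar>real_of_int b\<bar> \<le> s * B" using s(3) AB by (simp add: pos_divide_le_eq)
  have s0: "0 \<le> s" using s(1) by linarith
  have det': "\<bar>real_of_int a * real_of_int d - real_of_int b * real_of_int c\<bar> = 1"
    using det by (metis of_int_1 of_int_abs of_int_diff of_int_mult)
  \<comment> \<open>As the determinant is 1 or -1, solving for the two gradient components by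
    Cramer's rule loses no constant.\<close>
  have cramer: "\<bar>u\<bar> \<le> K"
    if "\<bar>real_of_int a * real_of_int d - real_of_int b * real_of_int c\<bar> * \<bar>u\<bar> \<le> K" for u K
    using that det' by simp
  have coeff0: "\<bar>real_of_int (h 0)\<bar> \<le> 2 * A" using h.coeff_bound[of 0] by simp
  have coeff1: "\<bar>real_of_int (h 1)\<bar> \<le> 2 * (A * B)" using h.coeff_bound[of 1] n by simp
  have coeffn: "\<bar>real_of_int (h n)\<bar> \<le> 2 * (A * B ^ n)" using h.coeff_bound[of n] by simp
  have coeffn1: "\<bar>real_of_int (h (n - 1))\<bar> \<le> 2 * (A * B ^ (n - 1))" using h.coeff_bound[of "n - 1"] by simp
  have Bn: "B ^ n = B * B ^ (n - 1)" using n by (simp flip: power_Suc)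
  define p where "p = B ^ (n - 1)"
  have p: "p > 0" using AB by (simp add: p_def)
  have coeffn': "\<bar>real_of_int (h n)\<bar> \<le> 2 * (A * (B * p))" using coeffn unfolding Bn p_def .
  have coeffn1': "\<bar>real_of_int (h (n - 1))\<bar> \<le> 2 * (A * p)" using coeffn1 unfolding p_def .
  have sB0: "0 \<le> s * B" using s0 AB by simp
  let ?K = "2 * (real n + 1) * s"
  \<comment> \<open>Euler's identity and the derivative along the other column determine the gradient at each column.\<close>
  have first: "max \<bar>real_of_int a\<bar> (B * \<bar>real_of_int c\<bar>) ^ (n - 1) * (real n / 2) \<le> ?K"
  proof -
    define u v where "u = real_of_int (form_grad_x n f a c)" and "v = real_of_int (form_grad_y n f a c)"
    have e0: "real n * real_of_int (h 0) = real_of_int a * u + real_of_int c * v"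
      unfolding u_def v_def substituted_coeffs_first(1)[OF n1 subst]
      by (metis form_euler of_int_add of_int_mult of_int_of_nat_eq)
    have e1: "real_of_int (h 1) = real_of_int b * u + real_of_int d * v"
      unfolding u_def v_def substituted_coeffs_first(2)[OF n1 subst] by simp
    have "\<bar>u\<bar> \<le> A * ?K"
    proof (rule cramer)
      have "(real_of_int a * real_of_int d - real_of_int b * real_of_int c) * u
          = real_of_int d * (real n * real_of_int (h 0)) - real_of_int c * real_of_int (h 1)"
        unfolding e0 e1 by (simp add: algebra_simps)
      then have "\<bar>real_of_int a * real_of_int d - real_of_int b * real_of_int c\<bar> * \<bar>u\<bar>
          \<le> \<bar>real_of_int d\<bar> * (real n * \<bar>real_of_int (h 0)\<bar>) + \<bar>real_of_int c\<bar> * \<bar>real_of_int (h 1)\<bar>"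
        unfolding abs_mult[symmetric] by (metis abs_mult abs_of_nat abs_triangle_ineq4)
      also have "\<dots> \<le> s * (real n * (2 * A)) + \<bar>real_of_int c\<bar> * (2 * (A * B))"
        using s coeff0 coeff1 s0 by (intro add_mono mult_mono) auto
      also have "\<bar>real_of_int c\<bar> * (2 * (A * B)) = 2 * A * (B * \<bar>real_of_int c\<bar>)" by simp
      also have "2 * A * (B * \<bar>real_of_int c\<bar>) \<le> 2 * A * s"
        using s AB by (intro mult_left_mono) auto
      finally show "\<bar>real_of_int a * real_of_int d - real_of_int b * real_of_int c\<bar> * \<bar>u\<bar> \<le> A * ?K"
        by (simp add: algebra_simps)
    qed
    moreover have "\<bar>v\<bar> \<le> A * B * ?K"
    proof (rule cramer)
      have "(real_of_int a * real_of_int d - real_of_int b * real_of_int c) * v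
          = real_of_int a * real_of_int (h 1) - real_of_int b * (real n * real_of_int (h 0))"
        unfolding e0 e1 by (simp add: algebra_simps)
      then have "\<bar>real_of_int a * real_of_int d - real_of_int b * real_of_int c\<bar> * \<bar>v\<bar>
          \<le> \<bar>real_of_int a\<bar> * \<bar>real_of_int (h 1)\<bar> + \<bar>real_of_int b\<bar> * (real n * \<bar>real_of_int (h 0)\<bar>)"
        unfolding abs_mult[symmetric] by (metis abs_mult abs_of_nat abs_triangle_ineq4)
      also have "\<dots> \<le> s * (2 * (A * B)) + s * B * (real n * (2 * A))"
        using s sb coeff0 coeff1 s0 AB by (intro add_mono mult_mono) auto
      finally show "\<bar>real_of_int a * real_of_int d - real_of_int b * real_of_int c\<bar> * \<bar>v\<bar> \<le> A * B * ?K"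
        by (simp add: algebra_simps)
    qed
    ultimately show ?thesis
      unfolding u_def v_def by (rule f.gradient_lower_bound)
  qed
  have second: "max \<bar>real_of_int b\<bar> (B * \<bar>real_of_int d\<bar>) ^ (n - 1) * (real n / 2) \<le> p * ?K"
  proof -
    define u v where "u = real_of_int (form_grad_x n f b d)" and "v = real_of_int (form_grad_y n f b d)"
    have e0: "real n * real_of_int (h n) = real_of_int b * u + real_of_int d * v"
      unfolding u_def v_def substituted_coeffs_last(1)[OF n1 subst]
      by (metis form_euler of_int_add of_int_mult of_int_of_nat_eq)
    have e1: "real_of_int (h (n - 1)) = real_of_int a * u + real_of_int c * v"
      unfolding u_def v_def substituted_coeffs_last(2)[OF n1 subst] by simp
    have "\<bar>u\<bar> \<le> A * (p * ?K)"
    proof (rule cramer)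
      have "(real_of_int a * real_of_int d - real_of_int b * real_of_int c) * u
          = real_of_int d * real_of_int (h (n - 1)) - real_of_int c * (real n * real_of_int (h n))"
        unfolding e0 e1 by (simp add: algebra_simps)
      then have "\<bar>real_of_int a * real_of_int d - real_of_int b * real_of_int c\<bar> * \<bar>u\<bar>
          \<le> \<bar>real_of_int d\<bar> * \<bar>real_of_int (h (n - 1))\<bar> + \<bar>real_of_int c\<bar> * (real n * \<bar>real_of_int (h n)\<bar>)"
        unfolding abs_mult[symmetric] by (metis abs_mult abs_of_nat abs_triangle_ineq4)
      also have "\<dots> \<le> s * (2 * (A * p)) + \<bar>real_of_int c\<bar> * (real n * (2 * (A * (B * p))))"
        by (intro add_mono mult_mono[OF s(4) coeffn1' s0] mult_left_mono[OF mult_left_mono[OF coeffn']]) auto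
      also have "\<bar>real_of_int c\<bar> * (real n * (2 * (A * (B * p)))) = 2 * A * p * real n * (B * \<bar>real_of_int c\<bar>)" by simp
      also have "2 * A * p * real n * (B * \<bar>real_of_int c\<bar>) \<le> 2 * A * p * real n * s"
        using s AB p by (intro mult_left_mono) auto
      finally show "\<bar>real_of_int a * real_of_int d - real_of_int b * real_of_int c\<bar> * \<bar>u\<bar> \<le> A * (p * ?K)"
        by (simp add: algebra_simps)
    qed
    moreover have "\<bar>v\<bar> \<le> A * B * (p * ?K)"
    proof (rule cramer)
      have "(real_of_int a * real_of_int d - real_of_int b * real_of_int c) * v
          = real_of_int a * (real n * real_of_int (h n)) - real_of_int b * real_of_int (h (n - 1))"
        unfolding e0 e1 by (simp add: algebra_simps)
      then have "\<bar>real_of_int a * real_of_int d - real_of_int b * real_of_int c\<bar> * \<bar>v\<bar>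
          \<le> \<bar>real_of_int a\<bar> * (real n * \<bar>real_of_int (h n)\<bar>) + \<bar>real_of_int b\<bar> * \<bar>real_of_int (h (n - 1))\<bar>"
        unfolding abs_mult[symmetric] by (metis abs_mult abs_of_nat abs_triangle_ineq4)
      also have "\<dots> \<le> s * (real n * (2 * (A * (B * p)))) + s * B * (2 * (A * p))"
        by (intro add_mono mult_mono[OF s(1) mult_left_mono[OF coeffn'] s0] mult_mono[OF sb coeffn1' sB0]) auto
      finally show "\<bar>real_of_int a * real_of_int d - real_of_int b * real_of_int c\<bar> * \<bar>v\<bar> \<le> A * B * (p * ?K)"
        by (simp add: algebra_simps)
    qed
    ultimately show ?thesis
      unfolding u_def v_def by (rule f.gradient_lower_bound)
  qed
  \<comment> \<open>Since n + 1 <= 2 n, division by n / 2 will leave 8 s, with no dependence on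
    n.\<close>
  have K: "?K \<le> 4 * s * (real n / 2) * 2"
  proof -
    have "2 * (real n + 1) * s \<le> 4 * real n * s"
      using n s0 by (intro mult_right_mono) auto
    also have "\<dots> = 4 * s * (real n / 2) * 2" by simp
    finally show ?thesis .
  qed
  have n2: "real n / 2 > 0" using n by simp
  have first': "max \<bar>real_of_int a\<bar> (B * \<bar>real_of_int c\<bar>) ^ (n - 1) \<le> 8 * s"
  proof -
    have "max \<bar>real_of_int a\<bar> (B * \<bar>real_of_int c\<bar>) ^ (n - 1) * (real n / 2) \<le> 8 * s * (real n / 2)"
      using first K by linarith
    then show ?thesis using n2 by (simp only: mult_le_cancel_right_pos)
  qed
  \<comment> \<open>Dividing by B rescales the second column; the factor p = B^(n-1), due to the
    larger size of the last coefficients of h, is absorbed.\<close>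
  have second': "(max \<bar>real_of_int b\<bar> (B * \<bar>real_of_int d\<bar>) / B) ^ (n - 1) \<le> 8 * s"
  proof -
    have "p * ?K \<le> p * (8 * s * (real n / 2))"
      using K p by (intro mult_left_mono) linarith+
    with second have "max \<bar>real_of_int b\<bar> (B * \<bar>real_of_int d\<bar>) ^ (n - 1) * (real n / 2) \<le> (p * (8 * s)) * (real n / 2)"
      by simp
    then have "max \<bar>real_of_int b\<bar> (B * \<bar>real_of_int d\<bar>) ^ (n - 1) \<le> p * (8 * s)"
      using n2 by (simp only: mult_le_cancel_right_pos)
    then show ?thesis using p unfolding power_divide p_def by (simp add: pos_divide_le_eq mult_ac)
  qed
  have "s ^ (n - 1) \<le> 8 * s"
  proof -
    have "s \<in> {\<bar>real_of_int a\<bar>, B * \<bar>real_of_int c\<bar>, \<bar>real_of_int b\<bar> / B, \<bar>real_of_int d\<bar>}"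
      unfolding s_def by (rule Max_in) auto
    then have "s \<le> max \<bar>real_of_int a\<bar> (B * \<bar>real_of_int c\<bar>) \<or> s \<le> max \<bar>real_of_int b\<bar> (B * \<bar>real_of_int d\<bar>) / B"
      using AB by (auto simp: le_max_iff_disj pos_le_divide_eq mult_ac)
    then show ?thesis
      using first' second' s0 by (meson order.trans power_mono)
  qed
  \<comment> \<open>Here n >= 3 enters: for s > 1 the exponent n - 1 is at least 2, so s^2 <= 8
    s.\<close>
  have s8: "s \<le> 8"
  proof (cases "s \<le> 1")
    case False
    then have "s ^ 2 \<le> s ^ (n - 1)" using n by (intro power_increasing) auto
    with \<open>s ^ (n - 1) \<le> 8 * s\<close> have "s * s \<le> 8 * s" by (simp add: power2_eq_square)
    then show ?thesis using False by simp
  qed simp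
  have ad: "\<bar>a\<bar> \<le> 8" "\<bar>d\<bar> \<le> 8" using s s8 by linarith+
  have Bc: "B * \<bar>real_of_int c\<bar> \<le> 8" using s s8 by linarith
  have "1 * \<bar>real_of_int c\<bar> \<le> B * \<bar>real_of_int c\<bar>" using B1 by (intro mult_right_mono) auto
  then have c: "\<bar>c\<bar> \<le> 8" using Bc by linarith
  \<comment> \<open>For B <= 8 the estimate |b| <= s B gives 64. For larger B, the bound B |c| <= 8
    forces c = 0 and leaves only a signed translation.\<close>
  have b: "\<bar>b\<bar> \<le> 64"
  proof (cases "B \<le> 8")
    case True
    have "s * B \<le> 8 * 8" using True s8 s0 B1 by (intro mult_mono) auto
    then show ?thesis using sb by linarith
  next
    case False
    have c0: "c = 0"
    proof (rule ccontr)
      assume "c \<noteq> 0"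
      then have "1 \<le> \<bar>real_of_int c\<bar>" by linarith
      then have "B * 1 \<le> B * \<bar>real_of_int c\<bar>" using AB by (intro mult_left_mono) auto
      then show False using Bc False by linarith
    qed
    then have "\<bar>a * d\<bar> = 1" using det by simp
    then have a1: "\<bar>a\<bar> = 1" and d1: "\<bar>d\<bar> = 1" by (auto simp: abs_mult zmult_eq_1_iff)
    have gx: "form_grad_x n f a 0 = (\<Sum>i\<le>n. if i = 0 then int n * f 0 * a ^ (n - 1) else 0)"
      unfolding form_grad_x_def by (intro sum.cong) auto
    have gy: "form_grad_y n f a 0 = (\<Sum>i\<le>n. if i = 1 then f 1 * a ^ (n - 1) else 0)"
      unfolding form_grad_y_def by (intro sum.cong) (auto simp: less_Suc_eq_0_disj)
    have "h 1 = (b * int n * f 0 + d * f 1) * a ^ (n - 1)"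
      using substituted_coeffs_first(2)[OF n1 subst] n unfolding c0 gx gy by (simp add: algebra_simps)
    then have "\<bar>h 1\<bar> = \<bar>b * int n * f 0 + d * f 1\<bar>"
      using a1 by (simp add: abs_mult power_abs)
    moreover have "\<bar>d * f 1\<bar> = \<bar>f 1\<bar>" using d1 by (simp add: abs_mult)
    ultimately have "\<bar>b * int n * f 0\<bar> \<le> \<bar>h 1\<bar> + \<bar>f 1\<bar>" by linarith
    then have "\<bar>real_of_int (b * int n * f 0)\<bar> \<le> \<bar>real_of_int (h 1)\<bar> + \<bar>real_of_int (f 1)\<bar>"
      by linarith
    then have up: "\<bar>real_of_int b\<bar> * (real n * \<bar>real_of_int (f 0)\<bar>) \<le> A / 4"
      using f1 h1 by (simp add: abs_mult mult.assoc)
    have "\<bar>real_of_int (f 0) - A\<bar> \<le> \<delta> * A" using f.error[of 0] by (simp add: fermat_coeff_def)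
    moreover have "\<delta> * A \<le> 1 / 8 * A" using f.delta_small AB by (intro mult_right_mono) auto
    ultimately have "A / 2 \<le> \<bar>real_of_int (f 0)\<bar>" by linarith
    then have "1 * (A / 2) \<le> real n * \<bar>real_of_int (f 0)\<bar>" using n AB by (intro mult_mono) auto
    \<comment> \<open>A nonzero b would change the coefficient with index 1 by at least A / 2, while
      the two such coefficients together allow only A / 4.\<close>
    have "b = 0"
    proof (rule ccontr)
      assume "b \<noteq> 0"
      then have "1 \<le> \<bar>real_of_int b\<bar>" by linarith
      then have "1 * (A / 2) \<le> \<bar>real_of_int b\<bar> * (real n * \<bar>real_of_int (f 0)\<bar>)"
        using \<open>1 * (A / 2) \<le> _\<close> AB by (intro mult_mono) auto
      then show False using up AB by linarith
    qed
    then show ?thesis by simp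
  qed
  show "a \<in> {-64..64}" "b \<in> {-64..64}" "c \<in> {-64..64}" "d \<in> {-64..64}"
    using ad b c by auto
qed

lemma gl2_orbit_self:
  assumes "f \<in> binary_forms n"
  shows "f \<in> gl2_orbit n f"
  unfolding gl2_orbit_def
proof (intro CollectI conjI)
  have "\<bar>1 * 1 - 0 * 0 :: int\<bar> = 1 \<and> (\<forall>x y. form_eval n f x y = form_eval n f (1 * x + 0 * y) (0 * x + 1 * y))"
    by simp
  then show "\<exists>a b c d. \<bar>a * d - b * c\<bar> = 1 \<and>
      (\<forall>x y. form_eval n f x y = form_eval n f (a * x + b * y) (c * x + d * y))"
    by blast
qed (use assms in simp)

text \<open>A form in the fibre is determined by a matrix carrying f to it, and each of the four
  entries has 129 possible values.\<close>

lemma card_orbit_fibre: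
  assumes n: "3 \<le> n" and S: "\<And>f. f \<in> S \<Longrightarrow> near_form n \<delta> A B f" and B1: "1 \<le> B"
    and S1: "\<And>f. f \<in> S \<Longrightarrow> \<bar>real_of_int (f 1)\<bar> \<le> A / 8"
    and f: "f \<in> S"
  shows "card {h \<in> S. gl2_orbit n h = gl2_orbit n f} \<le> 129 ^ 4"
proof -
  let ?F = "{h \<in> S. gl2_orbit n h = gl2_orbit n f}"
  let ?I = "{-64..64::int}"
  let ?Q = "?I \<times> ?I \<times> ?I \<times> ?I"
  define rel where "rel h q \<longleftrightarrow> (case q of (a, b, c, d) \<Rightarrow>
    \<forall>x y. form_eval n h x y = form_eval n f (a * x + b * y) (c * x + d * y))" for h q
  have "\<exists>q\<in>?Q. rel h q" if h: "h \<in> ?F" for h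
  proof -
    interpret h: near_form n \<delta> A B h using h S by blast
    have "h \<in> gl2_orbit n f" using h gl2_orbit_self[OF h.form] by auto
    then obtain a b c d where q: "\<bar>a * d - b * c\<bar> = 1"
      "\<And>x y. form_eval n h x y = form_eval n f (a * x + b * y) (c * x + d * y)"
      unfolding gl2_orbit_def by blast
    have "(a, b, c, d) \<in> ?Q"
      using substitution_entries_bounded[OF n S[OF f] S[of h] B1 S1[OF f] S1[of h] q] h by blast
    then show ?thesis using q(2) unfolding rel_def by blast
  qed
  then have "\<forall>h\<in>?F. \<exists>q. q \<in> ?Q \<and> rel h q" by blast
  from bchoice[OF this] obtain q where
    q: "\<And>h. h \<in> ?F \<Longrightarrow> q h \<in> ?Q" "\<And>h. h \<in> ?F \<Longrightarrow> rel h (q h)" by blast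
  have "inj_on q ?F"
  proof (rule inj_onI)
    fix h h' assume h: "h \<in> ?F" "h' \<in> ?F" "q h = q h'"
    have "form_eval n h x y = form_eval n h' x y" for x y
      using q(2)[OF h(1)] q(2)[OF h(2)] h(3) unfolding rel_def by (auto split: prod.splits)
    then show "h = h'"
      using h S near_form.form by (intro binary_forms_eqI) blast+
  qed
  then have "card ?F \<le> card ?Q"
  proof (rule card_inj_on_le)
    show "q ` ?F \<subseteq> ?Q" using q(1) by (rule image_subsetI)
  qed simp
  also have "card ?Q = 129 ^ 4" by (simp add: card_cartesian_product)
  finally show ?thesis .
qed

lemma card_le_mult_card_image:
  assumes "finite S" "\<And>x. x \<in> S \<Longrightarrow> card {y \<in> S. F y = F x} \<le> K"
  shows "card S \<le> K * card (F ` S)"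
proof -
  have "S = (\<Union>z\<in>F ` S. {y \<in> S. F y = z})" by auto
  then have "card S \<le> (\<Sum>z\<in>F ` S. card {y \<in> S. F y = z})"
    using card_UN_le[of "F ` S" "\<lambda>z. {y \<in> S. F y = z}"] assms(1) by simp
  also have "\<dots> \<le> of_nat (card (F ` S)) * K"
    using assms(2) by (intro sum_bounded_above) auto
  finally show ?thesis by (simp add: mult.commute)
qed

section \<open>Counting\<close>

lemma card_int_funs:
  fixes I :: "nat \<Rightarrow> int set" and n :: nat
  assumes "\<And>i. finite (I i)"
  defines "S \<equiv> {f. \<forall>i. (i \<le> n \<longrightarrow> f i \<in> I i) \<and> (n < i \<longrightarrow> f i = 0)}"
  shows "finite S" "card S = (\<Prod>i\<le>n. card (I i))"
proof -
  have bij: "bij_betw (\<lambda>f i. if i \<le> n then f i else 0) (PiE {..n} I) S"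
    by (rule bij_betw_byWitness[where f' = "\<lambda>f. restrict f {..n}"])
      (auto simp: S_def fun_eq_iff restrict_def PiE_def extensional_def Pi_iff)
  show "finite S"
    using bij_betw_finite[OF bij] finite_PiE[of "{..n}" I] assms(1) by simp
  show "card S = (\<Prod>i\<le>n. card (I i))"
    using bij_betw_same_card[OF bij] card_PiE[of "{..n}" I] by simp
qed

lemma card_int_interval_from_0: "0 \<le> h \<Longrightarrow> h \<le> real (card {0..\<lfloor>h\<rfloor>})"
  by simp

lemma card_int_interval:
  fixes x h :: real
  assumes "2 \<le> h"
  shows "h / 2 \<le> real (card {\<lceil>x\<rceil>..\<lfloor>x + h\<rfloor>})"
  using assms by simp linarith

text \<open>The index 1 is left out because that coefficient ranges over a set of size A rather than
  A B.\<close>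

lemma sum_exponents:
  fixes n :: nat
  assumes "1 \<le> n"
  shows "(\<Sum>i\<le>n. if i = 1 then 0 else i) + 1 = n * (n + 1) div 2"
proof -
  have "(\<Sum>i\<le>n. i) = (\<Sum>i\<le>n. (if i = 1 then 0 else i) + (if i = 1 then 1 else 0))"
    by (intro sum.cong) auto
  also have "\<dots> = (\<Sum>i\<le>n. if i = 1 then 0 else i) + (\<Sum>i\<le>n. if i = 1 then 1 else 0)"
    by (rule sum.distrib)
  also have "(\<Sum>i\<le>n. if i = 1 then 1 else 0) = (1 :: nat)"
    using assms by (subst sum.delta) auto
  finally have "(\<Sum>i\<le>n. i) = (\<Sum>i\<le>n. if i = 1 then 0 else i) + 1" .
  moreover have "(\<Sum>i\<le>n. i) = n * (n + 1) div 2"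
    using gauss_sum_nat[of n] by (simp only: atLeast0AtMost Suc_eq_plus1)
  ultimately show ?thesis by simp
qed

text \<open>A box of integer forms is counted side by side and divided by the fibre bound. The
  alternative A = 1 covers the endpoint of the segment where A does not grow.\<close>

lemma many_orbits_near:
  assumes n: "3 \<le> n" and \<delta>: "0 < \<delta>" "8 * (real n + 1) * 2 ^ n * \<delta> \<le> 1"
    and AB1: "1 \<le> A" "1 \<le> B" and A: "A = 1 \<or> 2 \<le> \<delta> * A" and ABn: "2 \<le> \<delta> * (A * B ^ n)"
  shows "\<exists>S\<subseteq>near_forms n \<delta> A B. finite S \<and>
    (\<delta> / 2) ^ (n + 1) * (A ^ (n + 1) * B ^ (n * (n + 1) div 2 - 1)) \<le> 129 ^ 4 * real (card (gl2_orbit n ` S))"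
proof -
  \<comment> \<open>The scale A at index 1, in place of A B, fixes the translations.\<close>
  define w where "w i = A * B ^ (if i = 1 then 0 else i)" for i
  \<comment> \<open>Sides at the two unit coefficients of the model start at the model value. The
    other sides start at 0, so they contain an integer however short they are.\<close>
  define I where "I i = (if i = 0 \<or> i = n then {\<lceil>w i\<rceil>..\<lfloor>w i + \<delta> * w i\<rfloor>} else {0..\<lfloor>\<delta> * w i\<rfloor>})" for i
  define S where "S = {f. \<forall>i. (i \<le> n \<longrightarrow> f i \<in> I i) \<and> (n < i \<longrightarrow> f i = 0)}"
  have finI: "finite (I i)" for i by (simp add: I_def)
  have w: "0 < w i" "w i \<le> A * B ^ i" for i
  proof -
    show "0 < w i" using AB1 by (simp add: w_def)
    show "w i \<le> A * B ^ i"
      unfolding w_def using AB1 by (intro mult_left_mono power_increasing) auto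
  qed
  have near: "S \<subseteq> near_forms n \<delta> A B"
  proof
    fix f assume f: "f \<in> S"
    have "\<bar>real_of_int (f i) - A * B ^ i * fermat_coeff n i\<bar> \<le> \<delta> * (A * B ^ i)" if i: "i \<le> n" for i
    proof (cases "i = 0 \<or> i = n")
      case True
      then have wi: "w i = A * B ^ i" using n by (auto simp: w_def)
      have "f i \<in> {\<lceil>w i\<rceil>..\<lfloor>w i + \<delta> * w i\<rfloor>}" using f i True by (auto simp: S_def I_def)
      then have "w i \<le> real_of_int (f i)" "real_of_int (f i) \<le> w i + \<delta> * w i"
        by (auto simp: ceiling_le_iff le_floor_iff)
      then show ?thesis using True by (simp add: wi fermat_coeff_def)
    next
      case False
      have "f i \<in> {0..\<lfloor>\<delta> * w i\<rfloor>}" using f i False by (auto simp: S_def I_def)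
      then have "0 \<le> real_of_int (f i)" "real_of_int (f i) \<le> \<delta> * w i"
        by (auto simp: le_floor_iff)
      moreover have "\<delta> * w i \<le> \<delta> * (A * B ^ i)" using w(2) \<delta> by (intro mult_left_mono) auto
      ultimately show ?thesis using False by (simp add: fermat_coeff_def)
    qed
    then show "f \<in> near_forms n \<delta> A B" using f by (simp add: near_forms_def binary_forms_def S_def)
  qed
  have nf: "near_form n \<delta> A B f" if "f \<in> S" for f
    using that near n \<delta> AB1 by unfold_locales auto
  have f1: "\<bar>real_of_int (f 1)\<bar> \<le> A / 8" if f: "f \<in> S" for f
  proof -
    have "f 1 \<in> I 1" using f n by (simp add: S_def)
    then have "f 1 \<in> {0..\<lfloor>\<delta> * w 1\<rfloor>}" using n by (simp add: I_def)
    then have "0 \<le> real_of_int (f 1)" "real_of_int (f 1) \<le> \<delta> * A"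
      by (auto simp: le_floor_iff w_def)
    moreover have "\<delta> * A \<le> 1 / 8 * A"
      using near_form.delta_small(2)[OF nf[OF f]] AB1 by (intro mult_right_mono) auto
    ultimately show ?thesis by simp
  qed
  have card: "\<delta> / 2 * w i \<le> real (card (I i))" if i: "i \<le> n" for i
  proof -
    have nonneg: "0 \<le> \<delta> * w i" using w(1)[of i] \<delta> by simp
    have "A = 1 \<or> 2 \<le> \<delta> * w 0" "2 \<le> \<delta> * w n" using A ABn n by (simp_all add: w_def)
    then consider "i = 0" "A = 1" | "i = 0 \<or> i = n" "2 \<le> \<delta> * w i" | "i \<noteq> 0" "i \<noteq> n"
      by metis
    then show ?thesis
    proof cases
      \<comment> \<open>The interval from 1 to 1 + \<delta> may be shorter than 1, but it contains
        the integer 1, which suffices as \<delta> <= 1.\<close>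
      case 1
      have "{1} \<subseteq> I 0" using 1 \<delta> by (auto simp: I_def w_def le_floor_iff)
      then have "1 \<le> card (I 0)" using card_mono[OF finI, of "{1}" 0] by simp
      moreover have "\<delta> \<le> 1"
      proof -
        have "1 * 1 * \<delta> \<le> 8 * (real n + 1) * 2 ^ n * \<delta>" using \<delta> by (intro mult_right_mono mult_mono) auto
        then show ?thesis using \<delta>(2) by linarith
      qed
      ultimately show ?thesis using 1 by (simp add: w_def)
    next
      case 2
      then show ?thesis using card_int_interval[of "\<delta> * w i" "w i"] by (simp add: I_def)
    next
      case 3
      then have "\<delta> * w i \<le> real (card (I i))"
        using card_int_interval_from_0[OF nonneg] by (simp add: I_def)
      then show ?thesis using nonneg by linarith
    qed
  qed
  have "(\<delta> / 2) ^ (n + 1) * (A ^ (n + 1) * B ^ (n * (n + 1) div 2 - 1)) = (\<Prod>i\<le>n. \<delta> / 2 * w i)"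
  proof -
    have "(\<Prod>i\<le>n. B ^ (if i = 1 then 0 else i)) = B ^ (n * (n + 1) div 2 - 1)"
    proof -
      have "(\<Sum>i\<le>n. if i = 1 then 0 else i) = n * (n + 1) div 2 - 1"
        using sum_exponents[of n] n by simp
      then show ?thesis by (simp only: power_sum[symmetric])
    qed
    moreover have "(\<Prod>i\<le>n. \<delta> / 2 * w i) = (\<delta> / 2) ^ (n + 1) * (A ^ (n + 1) * (\<Prod>i\<le>n. B ^ (if i = 1 then 0 else i)))"
      unfolding w_def by (simp only: prod.distrib prod_constant card_atMost Suc_eq_plus1)
    ultimately show ?thesis by (simp only:)
  qed
  also have "\<dots> \<le> (\<Prod>i\<le>n. real (card (I i)))"
    using card w(1) \<delta> by (intro prod_mono) (auto intro: less_imp_le)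
  also have "\<dots> = real (card S)"
    using card_int_funs(2)[of I n, OF finI] by (simp add: S_def)
  also have "\<dots> \<le> real (129 ^ 4 * card (gl2_orbit n ` S))"
  proof -
    have "card S \<le> 129 ^ 4 * card (gl2_orbit n ` S)"
    proof (rule card_le_mult_card_image)
      show "finite S" using card_int_funs(1)[of I n, OF finI] by (simp add: S_def)
      show "card {h \<in> S. gl2_orbit n h = gl2_orbit n f} \<le> 129 ^ 4" if "f \<in> S" for f
        by (rule card_orbit_fibre[where \<delta> = \<delta> and A = A and B = B]) (fact n nf AB1(2) f1 that)+
    qed
    then show ?thesis by (simp only: of_nat_le_iff)
  qed
  finally show ?thesis
    using near card_int_funs(1)[of I n, OF finI] by (intro exI[of _ S]) (simp add: S_def)
qed

text \<open>Up to constants, ln \<mu> is p ln X and ln \<Delta> is ln X, so ln \<mu> - p ln \<Delta>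
  is bounded. For X >= 16 the divisor ln \<Delta> is at least half of ln X, which accounts for the
  factor 2.\<close>

lemma log_close:
  assumes p: "0 \<le> p" "p \<le> 1" and X: "16 \<le> X" and CD: "1 \<le> C" "1 \<le> D"
    and \<Delta>: "X / 4 \<le> \<Delta>" "\<Delta> \<le> X"
    and \<mu>: "(X / D) powr p \<le> C * \<mu>" "\<mu> \<le> C * (X / D) powr p"
  shows "\<bar>log \<Delta> \<mu> - p\<bar> \<le> 2 * (ln C + ln D + ln 4) / ln X"
proof -
  define Y where "Y = X / D"
  have Y: "Y > 0" using X CD by (simp add: Y_def)
  have \<Delta>0: "\<Delta> > 0" using X \<Delta> by linarith
  have "0 < C * \<mu>" using \<mu>(1) Y by (smt (verit) Y_def powr_gt_zero)
  then have \<mu>0: "\<mu> > 0" using CD by (simp add: zero_less_mult_iff)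
  have lnY: "ln Y = ln X - ln D" using X CD by (simp add: Y_def ln_div)
  have "ln (Y powr p) \<le> ln (C * \<mu>)" "ln \<mu> \<le> ln (C * Y powr p)"
    using \<mu> \<mu>0 Y CD unfolding Y_def[symmetric] by (subst ln_le_cancel_iff; simp)+
  then have ln\<mu>: "p * ln Y \<le> ln C + ln \<mu>" "ln \<mu> \<le> ln C + p * ln Y"
    using \<mu>0 Y CD by (simp_all add: ln_mult ln_powr)
  have ln\<Delta>: "ln X - ln 4 \<le> ln \<Delta>" "ln \<Delta> \<le> ln X"
  proof -
    have "ln (X / 4) \<le> ln \<Delta>" using \<Delta> X by simp
    then show "ln X - ln 4 \<le> ln \<Delta>" using X by (simp add: ln_div)
    show "ln \<Delta> \<le> ln X" using \<Delta> \<Delta>0 by simp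
  qed
  have half: "ln X / 2 \<le> ln \<Delta>"
  proof -
    have "ln (4 * 4) \<le> ln X" using X by simp
    then have "2 * ln 4 \<le> ln X" by (simp only: ln_mult) simp
    then show ?thesis using ln\<Delta> by linarith
  qed
  have lnX: "ln X > 0" using X by simp
  have lnCD: "0 \<le> ln C" "0 \<le> ln D" using CD by simp_all
  have "\<bar>p * (ln Y - ln \<Delta>)\<bar> \<le> 1 * (ln D + ln 4)"
    unfolding abs_mult using p ln\<Delta> lnCD lnY by (intro mult_mono) auto
  then have "\<bar>p * ln Y - p * ln \<Delta>\<bar> \<le> ln D + ln 4" by (simp add: right_diff_distrib)
  then have num: "\<bar>ln \<mu> - p * ln \<Delta>\<bar> \<le> ln C + ln D + ln 4" using ln\<mu> by linarith
  have "log \<Delta> \<mu> - p = (ln \<mu> - p * ln \<Delta>) / ln \<Delta>"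
    using half lnX by (simp add: log_def field_simps)
  then have "\<bar>log \<Delta> \<mu> - p\<bar> = \<bar>ln \<mu> - p * ln \<Delta>\<bar> / ln \<Delta>"
    using half lnX by simp
  also have "\<dots> \<le> (ln C + ln D + ln 4) / (ln X / 2)"
    using num half lnX by (intro frac_le) auto
  finally show ?thesis by (simp add: mult.commute)
qed

section \<open>Exponents along the segment\<close>

lemma kappa_eq: "2 \<le> n \<Longrightarrow> kappa n = 1 / (real n * (real n - 1))"
proof -
  assume n: "2 \<le> n"
  have "2 * (\<Sum>i=1..m. real i) = real m * (real m + 1)" for m
    by (induction m) (auto simp: algebra_simps)
  from this[of "n - 1"] show ?thesis using n by (simp add: kappa_def of_nat_diff mult.commute)
qed

lemma seg_param:
  assumes "r \<in> seg n" "2 \<le> n"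
  obtains t where "0 \<le> t" "t \<le> 1" "snd r - fst r = (1 - t) * kappa n"
    "\<And>i. seg_map n r i = (1 - t) * (real i * kappa n) + t * (1 / (2 * (real n - 1)))"
proof -
  have \<kappa>: "kappa n > 0" using assms(2) by (simp add: kappa_eq)
  obtain t where t: "0 \<le> t" "t \<le> 1" "r = (1 - t) *\<^sub>R (0, kappa n) + t *\<^sub>R (kappa n / 2, kappa n / 2)"
    using assms(1) unfolding seg_def closed_segment_def by blast
  have "2 * fst r / kappa n = t" using t(3) \<kappa> by simp
  moreover have "snd r - fst r = (1 - t) * kappa n" using t(3) by simp
  ultimately show thesis using that[OF t(1,2)] by (simp add: seg_map_def)
qed

text \<open>Supplies the thresholds for X beyond which the sides of the box are long enough.\<close>

lemma powr_large:
  fixes X D K \<alpha> :: real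
  assumes "0 < \<alpha>" "0 < K" "0 < D" "D * K powr (1 / \<alpha>) \<le> X"
  shows "K \<le> (X / D) powr \<alpha>"
proof -
  have "K = (K powr (1 / \<alpha>)) powr \<alpha>" using assms by (simp add: powr_powr)
  also have "\<dots> \<le> (X / D) powr \<alpha>"
    using assms by (intro powr_mono2) (auto simp: pos_le_divide_eq mult.commute)
  finally show ?thesis .
qed

lemma near_forms_mono:
  assumes "\<delta> \<le> \<delta>'" "0 < A" "0 < B"
  shows "near_forms n \<delta> A B \<subseteq> near_forms n \<delta>' A B"
proof
  fix f assume f: "f \<in> near_forms n \<delta> A B"
  have "\<delta> * (A * B ^ i) \<le> \<delta>' * (A * B ^ i)" for i
    using assms by (intro mult_right_mono) auto
  with f show "f \<in> near_forms n \<delta>' A B"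
    unfolding near_forms_def by (auto intro: order.trans)
qed

section \<open>Choice of the box and proof of the lower bound\<close>

theorem theorem1p11:
  fixes n :: nat
  assumes "n \<ge> 3"
  shows "\<exists>M>0. \<forall>\<epsilon>>M. \<forall>r\<in>seg n. \<exists>c>0. \<exists>X0>1. \<forall>X\<ge>X0.
    emeasure (count_space UNIV) (forms_with_minima n (seg_map n r) \<epsilon> X)
      \<ge> ennreal (c * X powr ((real n + 1) / (2 * real n - 2) - (snd r - fst r)))"
proof -
  have n2: "2 \<le> n" and n3: "3 \<le> real n" using assms by simp_all
  obtain \<delta>0 where \<delta>0: "\<delta>0 > 0" and disc: "\<And>A B f. A > 0 \<Longrightarrow> B > 0 \<Longrightarrow> f \<in> near_forms n \<delta>0 A B \<Longrightarrow>
      real n ^ n / 2 * (A ^ (2 * n - 2) * B ^ (n * (n - 1))) \<le> \<bar>form_disc n f\<bar> \<and>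
      \<bar>form_disc n f\<bar> \<le> 2 * real n ^ n * (A ^ (2 * n - 2) * B ^ (n * (n - 1)))"
    using near_forms_disc_bounds[OF n2] by metis
  \<comment> \<open>The first bound controls the discriminant, the second is the smallness required
    by \<open>near_form\<close>.\<close>
  define \<delta> where "\<delta> = min \<delta>0 (1 / (8 * (real n + 1) * 2 ^ n))"
  have \<delta>: "0 < \<delta>" "\<delta> \<le> \<delta>0" "8 * (real n + 1) * 2 ^ n * \<delta> \<le> 1"
  proof -
    have pos: "0 < 8 * (real n + 1) * 2 ^ n" by simp
    then show "0 < \<delta>" using \<delta>0 by (simp add: \<delta>_def)
    show "\<delta> \<le> \<delta>0" by (simp add: \<delta>_def)
    have "\<delta> \<le> 1 / (8 * (real n + 1) * 2 ^ n)" by (simp add: \<delta>_def)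
    then show "8 * (real n + 1) * 2 ^ n * \<delta> \<le> 1"
      using pos by (simp only: pos_le_divide_eq mult.commute)
  qed
  define C where "C = real n * 2 ^ (n + 2)"
  \<comment> \<open>With Y = X / D, the upper bound 2 n^n Y for the discriminant becomes X and the
    lower bound becomes X / 4.\<close>
  define D where "D = 2 * real n ^ n"
  have "1 * 1 \<le> C" unfolding C_def using n3 by (intro mult_mono one_le_power) auto
  then have C: "1 \<le> C" by simp
  have "1 * 1 \<le> D" unfolding D_def using n3 by (intro mult_mono one_le_power) auto
  then have D: "1 \<le> D" by simp
  define M where "M = 2 * (ln C + ln D + ln 4)"
  have "M > 0" using C D by (simp add: M_def add_nonneg_pos)
  moreover have "\<exists>c>0. \<exists>X0>1. \<forall>X\<ge>X0.
      ennreal (c * X powr ((real n + 1) / (2 * real n - 2) - (snd r - fst r)))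
        \<le> emeasure (count_space UNIV) (forms_with_minima n (seg_map n r) \<epsilon> X)"
    if \<epsilon>: "\<epsilon> > M" and r: "r \<in> seg n" for \<epsilon> r
  proof -
    obtain t where t: "0 \<le> t" "t \<le> 1" "snd r - fst r = (1 - t) * kappa n"
      and seg_map: "\<And>i. seg_map n r i = (1 - t) * (real i * kappa n) + t * (1 / (2 * (real n - 1)))"
      using seg_param[OF r n2] by blast
    \<comment> \<open>A and B will be Y to the powers \<alpha> and \<beta>. Then A B^i has exponent
      \<alpha> + i \<beta>, the prescribed i-th minimum.\<close>
    define \<alpha> where "\<alpha> = t / (2 * real n - 2)"
    define \<beta> where "\<beta> = (1 - t) / (real n * (real n - 1))"
    define E where "E = (real n + 1) / (2 * real n - 2) - (snd r - fst r)"
    have \<alpha>\<beta>: "0 \<le> \<alpha>" "0 \<le> \<beta>" using t n3 by (simp_all add: \<alpha>_def \<beta>_def)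
    \<comment> \<open>At an endpoint of the segment one of A, B stays constant, but A B^n grows in
      all cases and makes room for the last coefficient.\<close>
    have pos: "0 < \<alpha> + real n * \<beta>"
    proof (cases "t = 0")
      case True
      then show ?thesis using n3 by (simp add: \<alpha>_def \<beta>_def)
    next
      case False
      then have "0 < \<alpha>" using t n3 by (simp add: \<alpha>_def)
      then show ?thesis using \<alpha>\<beta> by (intro add_pos_nonneg) auto
    qed
    have seg_map': "seg_map n r i = \<alpha> + real i * \<beta>" for i
      unfolding seg_map \<alpha>_def \<beta>_def kappa_eq[OF n2] by (simp add: algebra_simps)
    have disc_exp: "\<alpha> * real (2 * n - 2) + \<beta> * real (n * (n - 1)) = 1"
    proof -
      have "\<alpha> * real (2 * n - 2) = t" "\<beta> * real (n * (n - 1)) = 1 - t"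
        using n2 n3 by (simp_all add: \<alpha>_def \<beta>_def of_nat_diff)
      then show ?thesis by linarith
    qed
    have count_exp: "\<alpha> * real (n + 1) + \<beta> * real (n * (n + 1) div 2 - 1) = E"
    proof -
      have "1 \<le> n * (n + 1) div 2" using n2 by (cases n) auto
      then have "real (n * (n + 1) div 2 - 1) = real n * (real n + 1) / 2 - 1"
        by (simp add: of_nat_diff real_of_nat_div algebra_simps)
      moreover have "\<alpha> * (real n + 1) + \<beta> * (real n * (real n + 1) / 2 - 1) = E"
      proof -
        define u where "u = real n - 1"
        have u: "real n = u + 1" "u \<ge> 2" using n3 by (auto simp: u_def)
        show ?thesis
          unfolding E_def t(3) \<alpha>_def \<beta>_def kappa_eq[OF n2] u(1) using u(2)
          by (simp add: divide_simps) (simp add: algebra_simps)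
      qed
      ultimately show ?thesis by (simp add: add.commute)
    qed
    \<comment> \<open>The factor with D converts Y back to X; the denominator is the bound on the
      orbit fibres.\<close>
    define c where "c = (\<delta> / 2) ^ (n + 1) * (1 / D) powr E / 129 ^ 4"
    \<comment> \<open>When \<alpha> = 0 the quotient \<open>1 / \<alpha>\<close> is 0 by convention
      and the third entry reduces to D; in that case A = 1 is used instead.\<close>
    define X0 where "X0 = Max {16, D, D * (2 / \<delta>) powr (1 / \<alpha>), D * (2 / \<delta>) powr (1 / (\<alpha> + real n * \<beta>))}"
    have "c > 0" using \<delta> D by (simp add: c_def)
    moreover have "X0 > 1"
    proof -
      have "16 \<le> X0" unfolding X0_def by (intro Max_ge) auto
      then show ?thesis by simp
    qed
    moreover have "ennreal (c * X powr E) \<le> emeasure (count_space UNIV) (forms_with_minima n (seg_map n r) \<epsilon> X)"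
      if "X \<ge> X0" for X
    proof -
      have X: "16 \<le> X" "D \<le> X" "D * (2 / \<delta>) powr (1 / \<alpha>) \<le> X" "D * (2 / \<delta>) powr (1 / (\<alpha> + real n * \<beta>)) \<le> X"
        using that unfolding X0_def by simp_all
      define Y where "Y = X / D"
      have Y: "1 \<le> Y" using X D by (simp add: Y_def)
      define A where "A = Y powr \<alpha>"
      define B where "B = Y powr \<beta>"
      have AB1: "1 \<le> A" "1 \<le> B" using Y \<alpha>\<beta> by (simp_all add: A_def B_def ge_one_powr_ge_zero)
      have powers: "A ^ i * B ^ j = Y powr (\<alpha> * real i + \<beta> * real j)" for i j
        using Y by (simp add: A_def B_def powr_power powr_add mult.commute)
      have ABi: "A * B ^ i = Y powr seg_map n r i" for i
        using powers[of 1 i] by (simp add: seg_map' mult.commute)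
      have A: "A = 1 \<or> 2 \<le> \<delta> * A"
      proof (cases "\<alpha> = 0")
        case True
        then show ?thesis using Y by (simp add: A_def)
      next
        case False
        then have "2 / \<delta> \<le> A"
          unfolding A_def Y_def using \<alpha>\<beta> \<delta> D X by (intro powr_large) auto
        then show ?thesis using \<delta> by (simp add: pos_divide_le_eq mult.commute)
      qed
      have ABn: "2 \<le> \<delta> * (A * B ^ n)"
      proof -
        have "2 / \<delta> \<le> A * B ^ n"
          unfolding ABi seg_map' Y_def using pos \<delta> D X by (intro powr_large) auto
        then show ?thesis using \<delta> by (simp add: pos_divide_le_eq mult.commute)
      qed
      obtain S where S: "S \<subseteq> near_forms n \<delta> A B" "finite S"
        and count: "(\<delta> / 2) ^ (n + 1) * (A ^ (n + 1) * B ^ (n * (n + 1) div 2 - 1))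
          \<le> 129 ^ 4 * real (card (gl2_orbit n ` S))"
        using many_orbits_near[OF assms \<delta>(1,3) AB1 A ABn] by blast
      have "gl2_orbit n ` S \<subseteq> forms_with_minima n (seg_map n r) \<epsilon> X"
        unfolding forms_with_minima_def
      proof (intro image_mono subsetI CollectI conjI ballI)
        fix f assume "f \<in> S"
        then have near: "f \<in> near_forms n \<delta> A B" using S by blast
        have AB: "0 < A" "0 < B" using AB1 by simp_all
        have near0: "f \<in> near_forms n \<delta>0 A B" using near near_forms_mono[OF \<delta>(2) AB] by blast
        interpret near_form n \<delta> A B f
          by (rule near_form.intro[OF n2 AB less_imp_le[OF \<delta>(1)] \<delta>(3) near])
        have "A ^ (2 * n - 2) * B ^ (n * (n - 1)) = Y"
          unfolding powers disc_exp using Y by simp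
        then have "real n ^ n / 2 * Y \<le> \<bar>form_disc n f\<bar>" "\<bar>form_disc n f\<bar> \<le> 2 * real n ^ n * Y"
          using disc[OF AB near0] by simp_all
        moreover have "real n ^ n / 2 * Y = X / 4" "2 * real n ^ n * Y = X"
          using n3 by (simp_all add: Y_def D_def)
        ultimately have \<Delta>: "X / 4 \<le> \<bar>form_disc n f\<bar>" "\<bar>form_disc n f\<bar> \<le> X" by metis+
        show "f \<in> binary_forms n" by (rule form)
        show "0 < \<bar>form_disc n f\<bar>" using \<Delta>(1) X(1) by linarith
        show "\<bar>form_disc n f\<bar> \<le> X" by (rule \<Delta>(2))
        \<comment> \<open>To apply \<open>log_close\<close>, the prescribed exponent must lie in
          [0, 1]; it is at most t + (1 - t).\<close>
        fix i assume "i \<in> {1..<n}"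
        then have i: "1 \<le> i" "i < n" by auto
        have p: "seg_map n r i \<le> 1" "0 \<le> seg_map n r i"
        proof -
          have "real i * \<beta> \<le> (real n - 1) * \<beta>" using i \<alpha>\<beta> by (intro mult_right_mono) auto
          also have "\<dots> = (1 - t) / real n" using n3 by (simp add: \<beta>_def)
          also have "\<dots> \<le> (1 - t) / 1" using t n3 by (intro divide_left_mono) auto
          finally have "real i * \<beta> \<le> 1 - t" by simp
          moreover have "\<alpha> \<le> t / 1" unfolding \<alpha>_def using t n3 by (intro divide_left_mono) auto
          ultimately show "seg_map n r i \<le> 1" by (simp add: seg_map')
          show "0 \<le> seg_map n r i" using \<alpha>\<beta> by (simp add: seg_map')
        qed
        note bounds = succ_min_bounds[OF AB1 i, folded C_def, unfolded ABi Y_def]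
        have "\<bar>log \<bar>form_disc n f\<bar> (succ_min n (form_ring n f) i) - seg_map n r i\<bar> \<le> M / ln X"
          unfolding M_def
          by (rule log_close[OF p(2,1) X(1) C D \<Delta> bounds])
        also have "\<dots> \<le> \<epsilon> / ln X" using \<epsilon> X(1) by (intro divide_right_mono) auto
        finally show "\<bar>log \<bar>form_disc n f\<bar> (succ_min n (form_ring n f) i) - seg_map n r i\<bar> \<le> \<epsilon> / ln X" .
      qed
      \<comment> \<open>Counting measure bounds the whole set from below by its finite part,
        whatever the size of the whole.\<close>
      then have mono: "emeasure (count_space UNIV) (gl2_orbit n ` S)
          \<le> emeasure (count_space UNIV) (forms_with_minima n (seg_map n r) \<epsilon> X)"
        by (intro emeasure_mono) auto
      have "c * X powr E \<le> real (card (gl2_orbit n ` S))"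
      proof -
        have "X powr E * (1 / D) powr E = Y powr E"
          using X D by (simp add: Y_def flip: powr_mult)
        then have "c * X powr E = (\<delta> / 2) ^ (n + 1) * Y powr E / 129 ^ 4"
          by (simp add: c_def mult_ac)
        also have "Y powr E = A ^ (n + 1) * B ^ (n * (n + 1) div 2 - 1)"
          unfolding powers count_exp ..
        finally show ?thesis using count by simp
      qed
      then have "ennreal (c * X powr E) \<le> ennreal (real (card (gl2_orbit n ` S)))"
        by (rule ennreal_leI)
      also have "\<dots> = emeasure (count_space UNIV) (gl2_orbit n ` S)"
        using S(2) by (simp add: emeasure_count_space_finite ennreal_of_nat_eq_real_of_nat)
      also note mono
      finally show ?thesis .
    qed
    ultimately show ?thesis unfolding E_def by blast
  qed
  ultimately show ?thesis by blast
qed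

end
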